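(* Let $X_n^H:=\log|\det W_n^H|-\mu_n^H$, where $\mu_n^H=\frac12\log2\pi-\frac n2+\frac n2\log n$. Then, as $n\to\infty$, the sequence $(X_n^H)_{n\in\mathbb{N}}$ converges mod-Gaussian on the strip $S_1=\{z\in\mathbb{C}:\mathrm{Re}(z)>-1\}$ with parameters $t_n^H=\frac12\log\left(\frac n2\right)$ and limiting function $$\psi^H(z)=\frac{\Gamma\left(\frac12\right)}{\Gamma\left(\frac{z+1}2\right)}\,\frac{G\left(\frac12\right)^2}{G\left(\frac{z+1}2\right)^2}.$$
   Context: $W_n^H$ is a random $n\times n$ Hermitian matrix of the Gaussian Unitary Ensemble, normalized so that its eigenvalues have joint density on $\mathbb{R}^n$ proportional to $\prod_{1\le j<k\le n}|\lambda_k-\lambda_j|^2\prod_{k=1}^n e^{-\lambda_k^2/2}$. $G$ is the Barnes $G$-function (entire, $G(1)=1$, $G(z+1)=G(z)\Gamma(z)$, $G(1+z)=(2\pi)^{z/2}e^{-(z+1)z/2}\prod_{j\ge1}\{(1+\frac zj)^j(1+\frac1j)^{z^2/2}e^{-z}\}$). Mod-Gaussian convergence: real random variables $X_n$ with moment generating functions existing on a strip $S=\{c<\mathrm{Re}(z)<d\}$ ($-\infty\le c<0<d\le\infty$) converge mod-Gaussian on $S$ with parameters $t_n\to+\infty$ and limiting function $\psi:S\to\mathbb{C}$ if $\mathbb{E}[e^{zX_n}]e^{-t_nz^2/2}\to\psi(z)$ locally uniformly on $S$. *)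

theory Defs
  imports
    "HOL-Probability.Probability"
    "HOL-Combinatorics.Permutations"
    "Jordan_Normal_Form.Char_Poly"
    "Jordan_Normal_Form.Schur_Decomposition"
begin

section \<open>The Barnes G-function\<close>

text \<open>
  The Weierstrass product of \<open>G (1 + z)\<close>, taken at \<open>z = w - 1\<close>. The factor number \<open>j \<ge> 1\<close> of the
  product is indexed by \<open>j = Suc k\<close>. The bases of \<open>powr\<close> are positive reals, so no branch is
  chosen. The library's \<open>prodinf\<close> allows finitely many vanishing factors, which occur exactly for
  \<open>w\<close> a nonpositive integer.
\<close>

definition barnes_G :: "complex \<Rightarrow> complex" where
  "barnes_G w = (let z = w - 1 in
     complex_of_real (2 * pi) powr (z / 2) * exp (- ((z + 1) * z / 2)) *
     (\<Prod>k. (1 + z / of_nat (Suc k)) ^ Suc k *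
           complex_of_real (1 + 1 / real (Suc k)) powr (z\<^sup>2 / 2) * exp (- z)))"

lemma barnes_G_1: "barnes_G 1 = 1"
proof -
  have "(1 + 1 / complex_of_nat (Suc k)) \<noteq> 0" for k
    by (metis add_eq_0_iff add.right_neutral divide_eq_0_iff of_nat_Suc of_nat_neq_0
        add_divide_distrib divide_self of_nat_1 of_nat_add plus_1_eq_Suc add_Suc_right)
  then show ?thesis
    by (simp add: barnes_G_def del: of_nat_Suc)
qed

section \<open>Mod-Gaussian convergence\<close>

text \<open>
  Sequences are indexed by \<open>n \<ge> 1\<close>. The variables \<open>X n\<close> may live on different probability spaces
  \<open>M n\<close>. Locally uniform convergence on the open strip \<open>S\<close> means uniform convergence on some
  neighbourhood of each point.
\<close>

definition mod_gaussian_convergent ::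
  "(nat \<Rightarrow> 'w measure) \<Rightarrow> (nat \<Rightarrow> 'w \<Rightarrow> real) \<Rightarrow> complex set \<Rightarrow> (nat \<Rightarrow> real) \<Rightarrow>
   (complex \<Rightarrow> complex) \<Rightarrow> bool" where
  "mod_gaussian_convergent M X S t \<psi> \<longleftrightarrow>
     (\<exists>c d :: ereal. c < 0 \<and> 0 < d \<and> S = {z. c < ereal (Re z) \<and> ereal (Re z) < d}) \<and>
     (\<forall>n\<ge>1. prob_space (M n) \<and> X n \<in> borel_measurable (M n) \<and>
        (\<forall>z\<in>S. integrable (M n) (\<lambda>\<omega>. exp (z * complex_of_real (X n \<omega>))))) \<and>
     filterlim t at_top sequentially \<and>
     (\<forall>z\<^sub>0\<in>S. \<exists>U. open U \<and> z\<^sub>0 \<in> U \<and> U \<subseteq> S \<and>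
        uniform_limit U
          (\<lambda>n z. (\<integral>\<omega>. exp (z * complex_of_real (X n \<omega>)) \<partial>M n) *
                 exp (- (complex_of_real (t n) * z\<^sup>2 / 2)))
          \<psi> sequentially)"

section \<open>The Gaussian Unitary Ensemble\<close>

text \<open>
  The \<open>n\<^sup>2\<close> free real coordinates of a Hermitian matrix: the diagonal entries, the real parts of
  the entries above the diagonal, and (stored at the transposed position) their imaginary parts.
\<close>

definition hermitian_coord :: "complex mat \<Rightarrow> nat \<times> nat \<Rightarrow> real" where
  "hermitian_coord A = (\<lambda>(i, j). if i \<le> j then Re (A $$ (i, j)) else Im (A $$ (j, i)))"

text \<open>
  GUE with scale \<open>\<sigma>\<close>: independent centred Gaussian coordinates, of variance \<open>\<sigma>\<^sup>2\<close> on the diagonal and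
  \<open>\<sigma>\<^sup>2 / 2\<close> for each of the real and imaginary parts off the diagonal.
\<close>

definition is_GUE :: "nat \<Rightarrow> real \<Rightarrow> 'w measure \<Rightarrow> ('w \<Rightarrow> complex mat) \<Rightarrow> bool" where
  "is_GUE n \<sigma> M W \<longleftrightarrow>
     prob_space M \<and> \<sigma> > 0 \<and>
     (\<forall>\<omega>\<in>space M. W \<omega> \<in> carrier_mat n n \<and> mat_adjoint (W \<omega>) = W \<omega>) \<and>
     prob_space.indep_vars M (\<lambda>_. borel) (\<lambda>p \<omega>. hermitian_coord (W \<omega>) p) ({..<n} \<times> {..<n}) \<and>
     (\<forall>i<n. \<forall>j<n. distributed M lborel (\<lambda>\<omega>. hermitian_coord (W \<omega>) (i, j))
        (normal_density 0 (if i = j then \<sigma> else \<sigma> / sqrt 2)))"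

text \<open>The eigenvalues of a Hermitian matrix in increasing order, repeated by multiplicity.\<close>

definition sorted_eigenvalues :: "complex mat \<Rightarrow> real list" where
  "sorted_eigenvalues A =
     (THE xs. sorted xs \<and> char_poly A = (\<Prod>x\<leftarrow>xs. [:- complex_of_real x, 1:]))"

text \<open>
  A joint density on \<open>\<real>\<^sup>n\<close> of the (unordered) eigenvalues is a density of the vector obtained by
  listing the eigenvalues in a uniformly random order, independent of the matrix.
\<close>

definition has_eigenvalue_density ::
  "nat \<Rightarrow> 'w measure \<Rightarrow> ('w \<Rightarrow> complex mat) \<Rightarrow> ((nat \<Rightarrow> real) \<Rightarrow> real) \<Rightarrow> bool" where
  "has_eigenvalue_density n M W f \<longleftrightarrow>
     distributed (M \<Otimes>\<^sub>M uniform_count_measure {p. p permutes {..<n}}) (\<Pi>\<^sub>M i\<in>{..<n}. lborel)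
       (\<lambda>(\<omega>, p). \<lambda>i\<in>{..<n}. sorted_eigenvalues (W \<omega>) ! p i) (\<lambda>l. ennreal (f l))"

definition is_normalized_GUE :: "nat \<Rightarrow> 'w measure \<Rightarrow> ('w \<Rightarrow> complex mat) \<Rightarrow> bool" where
  "is_normalized_GUE n M W \<longleftrightarrow>
     (\<exists>\<sigma>. is_GUE n \<sigma> M W) \<and>
     (\<exists>C>0. has_eigenvalue_density n M W
        (\<lambda>l. C * ((\<Prod>k<n. \<Prod>j<k. \<bar>l k - l j\<bar>\<^sup>2) * (\<Prod>k<n. exp (- ((l k)\<^sup>2 / 2))))))"

end

theory Submission
  imports Defs "HOL-Real_Asymp.Real_Asymp"
begin

text \<open>
  The moment generating function of \<open>log \<bar>det W\<bar>\<close> is known in closed form, and the closed form is a product of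
  Gamma quotients whose partial products are essentially those of the Barnes function.

  \<^item> The absolute value of the determinant is the product of the absolute values of the eigenvalues, so
    \<open>E \<bar>det W\<bar>\<^sup>z\<close> is the integral of the squared Vandermonde product against the product weight
    \<open>\<bar>x\<bar>\<^sup>z exp (- x\<^sup>2 / 2)\<close>, divided by its value at \<open>z = 0\<close>. Writing the Vandermonde product as the determinant
    of monic orthogonal polynomials for this weight (the generalized Hermite polynomials) and expanding both
    determinants over permutations leaves only the diagonal terms: the integral is \<open>n!\<close> times the product of
    the squared norms of the polynomials (\<open>vandermonde_gauss_integral\<close>, \<open>GUE_det_moment\<close>). The weight is complex,
    but only the bilinear orthogonality relation is used, so every \<open>z\<close> with \<open>Re z > - 1\<close> is treated at once.

  \<^item> Up to a factor free of \<open>z\<close>, the \<open>k\<close>-th squared norm is a power of 2 times \<open>\<Gamma> ((z + 1) / 2 + \<lceil>k / 2\<rceil>)\<close>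
    (\<open>hermite_norm_ratio\<close>). Each shift \<open>\<lceil>k / 2\<rceil>\<close> other than \<open>0\<close> and possibly the last one occurs twice, which
    produces the square of the Barnes function in the limit and the single Gamma quotient in front of it.

  \<^item> With \<open>a = 1 + w\<close>, the product of \<open>\<Gamma> (a + k)\<close> over \<open>k < m\<close> equals \<open>\<Gamma> (a + m)\<^sup>m\<close> divided by the product of
    \<open>(a + j)\<^sup>j\<^sup>+\<^sup>1\<close> over \<open>j < m\<close>. The divisor is a partial product of \<open>G (1 + w)\<close> up to explicit elementary factors,
    and the logarithms of these partial products converge uniformly on bounded sets (\<open>barnes_log_uniform\<close>). What remains is the \<open>m\<close>-th power
    of \<open>\<Gamma> (a + m) / \<Gamma> (1 / 2 + m)\<close>; its logarithm is needed up to an error \<open>o (1 / m)\<close>, which comes from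
    summing the logarithms of the successive ratios (\<open>gamma_log_tail_uniform\<close>).

  Everything is kept in the form \<open>exp (\<Lambda>\<^sub>n (z))\<close> with an explicit exponent
  (\<open>prod_hermite_norm_ratio_eq_exp\<close>). The exponents converge uniformly on compact sets, and so do their
  exponentials. The exponential form also shows that the Barnes function in the denominator has no zeros on the strip.
\<close>

section \<open>Absolute moments of the Gaussian density\<close>

lemma right_halfplane_not_nonpos_Ints:
  "Re w > 0 \<Longrightarrow> w \<notin> \<int>\<^sub>\<le>\<^sub>0"
  using nonpos_Ints_subset_nonpos_Reals by (fastforce simp: complex_nonpos_Reals_iff)

text \<open>
  The density \<open>\<bar>x\<bar>\<^sup>z exp (- x\<^sup>2 / 2)\<close> for complex \<open>z\<close>. Since \<open>ln 0 = 0\<close>, its value at the origin is 1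
  whatever \<open>z\<close> is, which affects integrals only on a null set.
\<close>

definition gauss_weight :: "complex \<Rightarrow> real \<Rightarrow> complex" where
  "gauss_weight z x = exp (z * complex_of_real (ln \<bar>x\<bar>)) * complex_of_real (exp (- (x\<^sup>2 / 2)))"

definition gauss_moment :: "complex \<Rightarrow> complex" where
  "gauss_moment z = 2 powr ((z + 1) / 2) * Gamma ((z + 1) / 2)"

lemma measurable_gauss_weight [measurable]: "gauss_weight z \<in> borel_measurable borel"
  unfolding gauss_weight_def by measurable

lemma gauss_weight_minus: "gauss_weight z (- x) = gauss_weight z x"
  by (simp add: gauss_weight_def)

lemma gauss_weight_shift:
  assumes "x \<noteq> 0"
  shows "of_real x ^ (2 * l) * gauss_weight z x = gauss_weight (z + of_nat (2 * l)) x"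
proof -
  have "complex_of_real x ^ (2 * l) = of_real (\<bar>x\<bar> ^ (2 * l))"
    by (simp add: power_even_abs)
  also have "\<bar>x\<bar> ^ (2 * l) = exp (real (2 * l) * ln \<bar>x\<bar>)"
    using assms by (subst exp_of_nat_mult) simp
  finally show ?thesis
    by (simp add: gauss_weight_def exp_of_real [symmetric] exp_add ring_distribs mult_ac)
qed

lemma gauss_moment_add_2:
  assumes "Re z > - 1"
  shows "gauss_moment (z + 2) = (z + 1) * gauss_moment z"
proof -
  have nz: "(z + 1) / 2 \<notin> \<int>\<^sub>\<le>\<^sub>0"
    using assms by (intro right_halfplane_not_nonpos_Ints) simp
  have eq: "(z + 2 + 1) / 2 = (z + 1) / 2 + 1"
    by (simp add: field_simps)
  have "(2::complex) powr ((z + 1) / 2 + 1) = 2 * 2 powr ((z + 1) / 2)"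
    by (subst powr_add) simp
  then show ?thesis
    unfolding gauss_moment_def eq by (subst Gamma_plus1 [OF nz]) simp
qed

lemma gauss_moment_nonzero:
  assumes "Re z > - 1"
  shows "gauss_moment z \<noteq> 0"
proof -
  have "(z + 1) / 2 \<notin> \<int>\<^sub>\<le>\<^sub>0"
    using assms by (intro right_halfplane_not_nonpos_Ints) simp
  then show ?thesis
    by (simp add: gauss_moment_def Gamma_eq_zero_iff)
qed

text \<open>
  The substitution \<open>t = x\<^sup>2 / 2\<close> on the positive half-line turns Euler's integral for \<open>\<Gamma> ((z + 1) / 2)\<close> into half
  of this integral; the weight is even.
\<close>

lemma has_bochner_integral_gauss_weight:
  assumes "Re z > - 1"
  shows "has_bochner_integral lborel (gauss_weight z) (gauss_moment z)"
proof -
  define a where "a = (z + 1) / 2"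
  have a: "Re a > 0" using assms by (simp add: a_def)
  define f where "f = (\<lambda>t. 2 powr (a - 1) * (complex_of_real t powr (a - 1) / of_real (exp t)))"
  define g where "g = (\<lambda>x::real. x\<^sup>2 / 2)"
  have inj: "inj_on g {0<..}"
    by (auto simp: inj_on_def g_def)
  have img: "g ` {0<..} = {0<..}"
  proof safe
    fix t :: real assume "t > 0"
    then have "t = g (sqrt (2 * t))" "sqrt (2 * t) \<in> {0<..}" by (auto simp: g_def)
    then show "t \<in> g ` {0<..}" by blast
  qed (auto simp: g_def)
  have der: "(g has_field_derivative x) (at x within {0<..})" for x
    unfolding g_def by (auto intro!: derivative_eq_intros)
  have "f absolutely_integrable_on {0<..}"
    unfolding f_def by (intro set_integrable_mult_right absolutely_integrable_Gamma_integral' a)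
  moreover have "(f has_integral 2 powr (a - 1) * Gamma a) {0<..}"
    unfolding f_def by (intro has_integral_mult_right Gamma_integral_complex' a)
  ultimately have "f absolutely_integrable_on g ` {0<..} \<and>
      integral (g ` {0<..}) f = 2 powr (a - 1) * Gamma a"
    unfolding img by (auto intro: integral_unique)
  then have 1: "(\<lambda>x. \<bar>x\<bar> *\<^sub>R f (g x)) absolutely_integrable_on {0<..}"
      "integral {0<..} (\<lambda>x. \<bar>x\<bar> *\<^sub>R f (g x)) = 2 powr (a - 1) * Gamma a"
    using has_absolute_integral_change_of_variables_real [of "{0<..}" g "\<lambda>x. x" f, OF _ der inj]
    by auto
  have eq: "\<bar>x\<bar> *\<^sub>R f (g x) = gauss_weight z x" if "x \<in> {0<..}" for x :: real
  proof -
    have x: "x > 0" using that by simp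
    have "2 powr (a - 1) * complex_of_real (g x) powr (a - 1)
        = exp ((a - 1) * of_real (ln 2 + ln (x\<^sup>2 / 2)))"
      using x Ln_of_real [of 2] Ln_of_real [of "x\<^sup>2 / 2"]
      by (simp add: powr_def g_def exp_add distrib_left)
    also have "ln 2 + ln (x\<^sup>2 / 2) = 2 * ln x"
      using x by (simp add: ln_div ln_realpow)
    also have "(a - 1) * of_real (2 * ln x) = (z - 1) * complex_of_real (ln x)"
    proof -
      have "2 * (a - 1) = z - 1" by (simp add: a_def field_simps)
      then show ?thesis by (simp flip: mult.assoc) (simp add: mult_ac)
    qed
    finally have *: "2 powr (a - 1) * complex_of_real (g x) powr (a - 1) = exp ((z - 1) * of_real (ln x))" .
    have "complex_of_real x * exp ((z - 1) * of_real (ln x)) = exp (of_real (ln x) + (z - 1) * of_real (ln x))"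
      using x by (simp add: exp_add exp_of_real)
    then have **: "complex_of_real x * exp ((z - 1) * of_real (ln x)) = exp (z * of_real (ln x))"
      by (simp add: algebra_simps)
    have "\<bar>x\<bar> *\<^sub>R f (g x) = complex_of_real x * (2 powr (a - 1) * complex_of_real (g x) powr (a - 1)) / of_real (exp (g x))"
      using x by (simp add: f_def scaleR_conv_of_real)
    also have "\<dots> = gauss_weight z x"
      unfolding * ** gauss_weight_def using x by (simp add: g_def exp_minus field_simps)
    finally show ?thesis .
  qed
  have "gauss_weight z absolutely_integrable_on {0<..}"
    using 1(1) by (subst (asm) set_integrable_cong [OF refl refl eq]) (auto)
  moreover have "integral {0<..} (gauss_weight z) = 2 powr (a - 1) * Gamma a"
    using 1(2) eq by (metis (no_types, lifting) Henstock_Kurzweil_Integration.integral_cong)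
  ultimately have "set_integrable lborel {0<..} (gauss_weight z)"
    and *: "(LINT x:{0<..}|lebesgue. gauss_weight z x) = 2 powr (a - 1) * Gamma a"
    by (auto simp: set_integrable_def integrable_completion set_lebesgue_integral_eq_integral)
  moreover have "(LINT x:{0<..}|lborel. gauss_weight z x) = (LINT x:{0<..}|lebesgue. gauss_weight z x)"
    unfolding set_lebesgue_integral_def by (rule integral_completion [symmetric]) simp
  ultimately have "has_bochner_integral lborel (\<lambda>x. indicator {0<..} x *\<^sub>R gauss_weight z x) (2 powr (a - 1) * Gamma a)"
    by (simp add: has_bochner_integral_iff set_integrable_def set_lebesgue_integral_def)
  moreover have "AE x in lborel. indicator {0<..} x *\<^sub>R gauss_weight z x = indicator {0..} x *\<^sub>R gauss_weight z x"
    using AE_lborel_singleton [of "0::real"] by eventually_elim (auto simp: indicator_def)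
  ultimately have "has_bochner_integral lborel (\<lambda>x. indicator {0..} x *\<^sub>R gauss_weight z x) (2 powr (a - 1) * Gamma a)"
    by (subst (asm) has_bochner_integral_cong_AE) auto
  then have "has_bochner_integral lborel (gauss_weight z) (2 *\<^sub>R (2 powr (a - 1) * Gamma a))"
    by (rule has_bochner_integral_even_function) (simp add: gauss_weight_minus)
  also have "2 *\<^sub>R (2 powr (a - 1) * Gamma a) = gauss_moment z"
    by (simp add: gauss_moment_def a_def [symmetric] powr_diff scaleR_conv_of_real)
  finally show ?thesis .
qed

lemma has_bochner_integral_gauss_weight_even:
  assumes "Re z > - 1"
  shows "has_bochner_integral lborel (\<lambda>x. of_real x ^ (2 * l) * gauss_weight z x)
    (gauss_moment (z + of_nat (2 * l)))"
proof -
  have "AE x in lborel. of_real x ^ (2 * l) * gauss_weight z x = gauss_weight (z + of_nat (2 * l)) x"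
    using AE_lborel_singleton [of "0::real"] by eventually_elim (rule gauss_weight_shift)
  moreover have "has_bochner_integral lborel (gauss_weight (z + of_nat (2 * l))) (gauss_moment (z + of_nat (2 * l)))"
    using assms by (intro has_bochner_integral_gauss_weight) simp
  ultimately show ?thesis
    by (subst has_bochner_integral_cong_AE) auto
qed

text \<open>
  Odd powers are dominated by \<open>1 + x\<^sup>2\<^sup>k\<close>, so that the even moments suffice.
\<close>

lemma integrable_power_gauss_weight:
  assumes "Re z > - 1"
  shows "integrable lborel (\<lambda>x. of_real x ^ k * gauss_weight z x)"
proof (rule Bochner_Integration.integrable_bound)
  show "integrable lborel (\<lambda>x. of_real x ^ (2 * 0) * gauss_weight z x + of_real x ^ (2 * k) * gauss_weight z x)"
    using has_bochner_integral_gauss_weight_even [OF assms] by (intro Bochner_Integration.integrable_add) (auto simp only: has_bochner_integral_iff)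
  show "AE x in lborel. norm (of_real x ^ k * gauss_weight z x) \<le>
    norm (of_real x ^ (2 * 0) * gauss_weight z x + of_real x ^ (2 * k) * gauss_weight z x)"
  proof (rule AE_I2)
    fix x :: real
    have "\<bar>x\<bar> ^ k \<le> 1 + (\<bar>x\<bar> ^ k)\<^sup>2"
      using sum_squares_bound [of "\<bar>x\<bar> ^ k" 1] zero_le_power [of "\<bar>x\<bar>" k] by (simp add: power2_eq_square)
        (smt (verit) zero_le_square)
    also have "(\<bar>x\<bar> ^ k)\<^sup>2 = x ^ (2 * k)"
      by (simp add: power_mult [symmetric] mult.commute power_even_abs)
    finally have "\<bar>x\<bar> ^ k * cmod (gauss_weight z x) \<le> (1 + x ^ (2 * k)) * cmod (gauss_weight z x)"
      by (intro mult_right_mono) auto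
    also have "\<dots> = cmod (of_real (1 + x ^ (2 * k)) * gauss_weight z x)"
      by (simp only: norm_mult norm_of_real) (simp add: abs_of_nonneg)
    finally show "norm (of_real x ^ k * gauss_weight z x) \<le>
      norm (of_real x ^ (2 * 0) * gauss_weight z x + of_real x ^ (2 * k) * gauss_weight z x)"
      by (simp add: norm_mult norm_power distrib_right)
  qed
qed simp

lemma integral_gauss_weight_odd:
  assumes "Re z > - 1"
  shows "(\<integral>x. of_real x ^ (2 * l + 1) * gauss_weight z x \<partial>lborel) = 0"
proof -
  let ?f = "\<lambda>x. of_real x ^ (2 * l + 1) * gauss_weight z x"
  have "integral\<^sup>L lborel ?f = (\<integral>x. ?f (- x) \<partial>lborel)"
    using lborel_integral_real_affine [of "-1" ?f 0] by simp
  also have "\<dots> = (\<integral>x. - ?f x \<partial>lborel)"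
    by (simp add: gauss_weight_minus)
  also have "\<dots> = - integral\<^sup>L lborel ?f"
    by (rule Bochner_Integration.integral_minus)
  finally show ?thesis by simp
qed

section \<open>The Vandermonde determinant in a monic basis\<close>

text \<open>
  Passing from the monomials to a monic family multiplies the Vandermonde matrix by a triangular matrix with
  ones on the diagonal.
\<close>

lemma det_monic_family:
  fixes p q :: "nat \<Rightarrow> 'a :: comm_ring_1 poly"
  assumes "\<And>i. i < n \<Longrightarrow> degree (p i) \<le> i" "\<And>i. i < n \<Longrightarrow> coeff (p i) i = 1"
  shows "Determinant.det (mat n n (\<lambda>(i, j). poly (p i) (x j))) = Determinant.det (mat n n (\<lambda>(i, j). x j ^ i))"
proof -
  let ?C = "mat n n (\<lambda>(i, k). coeff (p i) k)" and ?V = "mat n n (\<lambda>(i, j). x j ^ i)"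
  have "mat n n (\<lambda>(i, j). poly (p i) (x j)) = ?C * ?V"
  proof (rule eq_matI)
    fix i j assume ij: "i < dim_row (?C * ?V)" "j < dim_col (?C * ?V)"
    have "poly (p i) (x j) = (\<Sum>k\<le>degree (p i). coeff (p i) k * x j ^ k)"
      by (rule poly_altdef)
    also have "\<dots> = (\<Sum>k<n. coeff (p i) k * x j ^ k)"
      using assms(1) [of i] ij by (intro sum.mono_neutral_left) (auto simp: coeff_eq_0)
    finally show "mat n n (\<lambda>(i, j). poly (p i) (x j)) $$ (i, j) = (?C * ?V) $$ (i, j)"
      using ij by (simp add: scalar_prod_def lessThan_atLeast0)
  qed auto
  moreover have "Determinant.det ?C = prod_list (diag_mat ?C)"
  proof (rule det_lower_triangular)
    fix i j assume "i < j" "j < n"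
    then have "degree (p i) < j" using assms(1) [of i] by simp
    then show "?C $$ (i, j) = 0" using \<open>i < j\<close> \<open>j < n\<close> by (simp add: coeff_eq_0)
  qed auto
  moreover have "diag_mat ?C = replicate n 1"
    using assms(2) by (intro nth_equalityI) (auto simp: diag_mat_def)
  ultimately show ?thesis
    by (simp add: det_mult [of _ n] prod_list_replicate)
qed

text \<open>
  Invariance under the choice of the monic family makes the induction short: the last monomial is replaced by
  the polynomial that vanishes at all the other nodes, and the last row then has a single nonzero entry.
\<close>

lemma det_vandermonde:
  fixes x :: "nat \<Rightarrow> 'a :: idom"
  shows "Determinant.det (mat n n (\<lambda>(i, j). x j ^ i)) = (\<Prod>k<n. \<Prod>j<k. x k - x j)"
proof (induction n)
  case 0
  show ?case by simp
next
  case (Suc n)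
  define p where "p i = (if i < n then monom 1 i else (\<Prod>j<n. [:- x j, 1:]))" for i
  have deg: "degree (\<Prod>j<n. [:- x j, 1:]) = n"
    by (subst degree_prod_eq_sum_degree) auto
  have lead: "coeff (\<Prod>j<n. [:- x j, 1:]) n = 1"
    using lead_coeff_prod [of "\<lambda>j. [:- x j, 1:]" "{..<n}"] deg by simp
  let ?A = "mat (Suc n) (Suc n) (\<lambda>(i, j). poly (p i) (x j))"
  have last: "?A $$ (n, j) = (if j = n then \<Prod>j<n. x n - x j else 0)" if "j < Suc n" for j
    using that by (auto simp: p_def poly_prod prod_zero_iff)
  have "Determinant.det (mat (Suc n) (Suc n) (\<lambda>(i, j). x j ^ i)) = Determinant.det ?A"
    by (rule det_monic_family [symmetric]) (auto simp: p_def degree_monom_le less_Suc_eq deg lead)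
  also have "\<dots> = (\<Sum>j<Suc n. ?A $$ (n, j) * cofactor ?A n j)"
    by (rule laplace_expansion_row) auto
  also have "\<dots> = (\<Prod>j<n. x n - x j) * cofactor ?A n n"
    by (subst sum.mono_neutral_right [of _ "{n}"]) (auto simp: last simp del: index_mat)
  also have "cofactor ?A n n = Determinant.det (mat_delete ?A n n)"
    by (simp add: cofactor_def)
  also have "mat_delete ?A n n = mat n n (\<lambda>(i, j). x j ^ i)"
    by (rule eq_matI) (auto simp: mat_delete_def p_def poly_monom)
  also have "Determinant.det \<dots> = (\<Prod>k<n. \<Prod>j<k. x k - x j)"
    by (rule Suc.IH)
  finally show ?case
    by (simp add: mult.commute)
qed

lemma vandermonde_sum_permutations:
  fixes x :: "nat \<Rightarrow> 'a :: idom" and p :: "nat \<Rightarrow> 'a poly"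
  assumes "\<And>i. i < n \<Longrightarrow> degree (p i) \<le> i" "\<And>i. i < n \<Longrightarrow> coeff (p i) i = 1"
  shows "(\<Prod>k<n. \<Prod>j<k. x k - x j) =
    (\<Sum>\<sigma> | \<sigma> permutes {..<n}. of_int (sign \<sigma>) * (\<Prod>i<n. poly (p (\<sigma> i)) (x i)))"
proof -
  let ?A = "mat n n (\<lambda>(i, j). poly (p i) (x j))"
  have "(\<Prod>k<n. \<Prod>j<k. x k - x j) = Determinant.det ?A"
    using det_monic_family [OF assms, of n x] by (simp add: det_vandermonde)
  also have "\<dots> = Determinant.det (transpose_mat ?A)"
    by (rule det_transpose [symmetric]) auto
  also have "\<dots> = (\<Sum>\<sigma> | \<sigma> permutes {..<n}. of_int (sign \<sigma>) * (\<Prod>i<n. poly (p (\<sigma> i)) (x i)))"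
    by (subst det_def' [of _ n]) (auto simp: lessThan_atLeast0 permutes_in_image intro!: sum.cong prod.cong)
  finally show ?thesis .
qed

section \<open>Generalized Hermite polynomials\<close>

text \<open>
  For an even weight the monic orthogonal polynomials satisfy \<open>p\<^sub>k\<^sub>+\<^sub>1 = x p\<^sub>k - c\<^sub>k p\<^sub>k\<^sub>-\<^sub>1\<close>. For
  \<open>\<bar>x\<bar>\<^sup>z exp (- x\<^sup>2 / 2)\<close> the coefficient \<open>c\<^sub>k\<close> is \<open>k\<close> for even \<open>k\<close> and \<open>k + z\<close> for odd \<open>k\<close>; at \<open>z = 0\<close> these are
  the probabilists' Hermite polynomials.
\<close>

definition hermite_rec_coeff :: "complex \<Rightarrow> nat \<Rightarrow> complex" where
  "hermite_rec_coeff z k = of_nat k + (if odd k then z else 0)"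

fun gen_hermite :: "complex \<Rightarrow> nat \<Rightarrow> complex poly" where
  "gen_hermite z 0 = 1"
| "gen_hermite z (Suc 0) = [:0, 1:]"
| "gen_hermite z (Suc (Suc k)) =
    [:0, 1:] * gen_hermite z (Suc k) - Polynomial.smult (hermite_rec_coeff z (Suc k)) (gen_hermite z k)"

lemma gen_hermite_monic: "degree (gen_hermite z k) \<le> k" "coeff (gen_hermite z k) k = 1"
proof -
  have "degree (gen_hermite z k) \<le> k \<and> coeff (gen_hermite z k) k = 1"
  proof (induction z k rule: gen_hermite.induct)
    case (3 z k)
    have "degree (gen_hermite z (Suc (Suc k))) \<le> Suc (Suc k)"
      using 3 by (auto intro!: degree_diff_le degree_pCons_le [THEN order_trans] degree_smult_le [THEN order_trans])
    moreover have "coeff (gen_hermite z k) (Suc (Suc k)) = 0"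
      using 3 by (intro coeff_eq_0) auto
    ultimately show ?case
      using 3 by simp
  qed auto
  then show "degree (gen_hermite z k) \<le> k" "coeff (gen_hermite z k) k = 1" by auto
qed

lemma integrable_poly_gauss_weight:
  assumes "Re z > - 1"
  shows "integrable lborel (\<lambda>x. poly p (complex_of_real x) * gauss_weight z x)"
  unfolding poly_altdef sum_distrib_right mult.assoc
  by (intro Bochner_Integration.integrable_sum integrable_mult_right integrable_power_gauss_weight assms)

text \<open>
  The moment functional of the complex weight. The pairing \<open>(p, q) \<mapsto> gauss_functional z (p * q)\<close> is bilinear, not
  Hermitian, which is what the determinantal expansion needs.
\<close>

definition gauss_functional :: "complex \<Rightarrow> complex poly \<Rightarrow> complex" where
  "gauss_functional z p = (\<integral>x. poly p (complex_of_real x) * gauss_weight z x \<partial>lborel)"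

lemma gauss_functional_diff:
  assumes "Re z > - 1"
  shows "gauss_functional z (p - q) = gauss_functional z p - gauss_functional z q"
  unfolding gauss_functional_def poly_diff left_diff_distrib
  by (intro Bochner_Integration.integral_diff integrable_poly_gauss_weight assms)

lemma gauss_functional_smult:
  "gauss_functional z (Polynomial.smult c p) = c * gauss_functional z p"
  by (simp add: gauss_functional_def mult.assoc)

lemma gauss_functional_sum:
  assumes "Re z > - 1"
  shows "gauss_functional z (\<Sum>i\<in>A. p i) = (\<Sum>i\<in>A. gauss_functional z (p i))"
  unfolding gauss_functional_def poly_sum sum_distrib_right
  by (intro Bochner_Integration.integral_sum integrable_poly_gauss_weight assms)

lemma gauss_functional_monom:
  assumes "Re z > - 1"
  shows "gauss_functional z (monom 1 (2 * l)) = gauss_moment (z + of_nat (2 * l))"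
    and "gauss_functional z (monom 1 (Suc (2 * l))) = 0"
  using has_bochner_integral_integral_eq [OF has_bochner_integral_gauss_weight_even [OF assms, of l]]
    integral_gauss_weight_odd [OF assms, of l]
  by (simp_all add: gauss_functional_def poly_monom)

text \<open>
  This is \<open>2\<^sup>j l (l - 1) \<dots> (l - j + 1)\<close>, the only nontrivial factor in the pairings of monomials with the
  orthogonal polynomials.
\<close>

definition even_falling :: "nat \<Rightarrow> nat \<Rightarrow> complex" where
  "even_falling l j = (\<Prod>r<j. 2 * of_nat l - 2 * of_nat r)"

lemma even_falling_0 [simp]: "even_falling l 0 = 1"
  by (simp add: even_falling_def)

lemma even_falling_Suc: "even_falling l (Suc j) = even_falling l j * (2 * of_nat l - 2 * of_nat j)"
  by (simp add: even_falling_def)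

lemma even_falling_Suc_Suc: "even_falling (Suc l) (Suc j) = (2 * of_nat l + 2) * even_falling l j"
  unfolding even_falling_def by (subst prod.lessThan_Suc_shift) (simp add: algebra_simps)

lemma even_falling_eq_0: "l < j \<Longrightarrow> even_falling l j = 0"
  by (auto simp: even_falling_def)

lemma even_falling_nonzero: "even_falling j j \<noteq> 0"
  by (auto simp: even_falling_def)

text \<open>
  Pairing a monomial with the recurrence expresses \<open>L (x\<^sup>a p\<^sub>k\<^sub>+\<^sub>1)\<close> by \<open>L (x\<^sup>a\<^sup>+\<^sup>1 p\<^sub>k)\<close> and \<open>L (x\<^sup>a p\<^sub>k\<^sub>-\<^sub>1)\<close>, so the closed
  forms follow by induction from the moments and the relation \<open>m (z + 2) = (z + 1) m (z)\<close>. They amount to a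
  triangular factorization of the Hankel matrix of the moments; orthogonality is visible in them because
  \<open>even_falling l j\<close> vanishes for \<open>l < j\<close>.
\<close>

lemma gauss_functional_monom_hermite:
  assumes z: "Re z > - 1"
  shows "gauss_functional z (monom 1 (2 * l) * gen_hermite z (2 * j)) =
      even_falling l j * gauss_moment (z + of_nat (2 * l))"
    and "gauss_functional z (monom 1 (Suc (2 * l)) * gen_hermite z (2 * j)) = 0"
    and "gauss_functional z (monom 1 (Suc (2 * l)) * gen_hermite z (Suc (2 * j))) =
      even_falling l j * gauss_moment (z + of_nat (2 * Suc l))"
    and "gauss_functional z (monom 1 (2 * l) * gen_hermite z (Suc (2 * j))) = 0"
proof -
  let ?L = "\<lambda>a k. gauss_functional z (monom 1 a * gen_hermite z k)"
  have rec: "?L a (Suc (Suc k)) = ?L (Suc a) (Suc k) - hermite_rec_coeff z (Suc k) * ?L a k" for a k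
  proof -
    have "monom 1 a * gen_hermite z (Suc (Suc k)) = monom 1 (Suc a) * gen_hermite z (Suc k)
        - Polynomial.smult (hermite_rec_coeff z (Suc k)) (monom 1 a * gen_hermite z k)"
      by (simp add: algebra_simps monom_Suc)
    then show ?thesis
      by (simp only: gauss_functional_diff [OF z] gauss_functional_smult)
  qed
  have "\<forall>l. ?L (2 * l) (2 * j) = even_falling l j * gauss_moment (z + of_nat (2 * l)) \<and>
    ?L (Suc (2 * l)) (2 * j) = 0 \<and>
    ?L (Suc (2 * l)) (Suc (2 * j)) = even_falling l j * gauss_moment (z + of_nat (2 * Suc l)) \<and>
    ?L (2 * l) (Suc (2 * j)) = 0"
  proof (induction j)
    case 0
    have *: "monom 1 a * [:0, 1:] = monom (1 :: complex) (Suc a)" for a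
      by (simp add: monom_Suc)
    have "?L (2 * l) 0 = gauss_moment (z + of_nat (2 * l))" "?L (Suc (2 * l)) 0 = 0"
      "?L (Suc (2 * l)) (Suc 0) = gauss_moment (z + of_nat (2 * Suc l))" "?L (2 * l) (Suc 0) = 0" for l
      using gauss_functional_monom [OF z, of l] gauss_functional_monom(1) [OF z, of "Suc l"]
      by (simp_all only: gen_hermite.simps mult_1_right * mult_Suc_right add_2_eq_Suc)
    then show ?case by simp
  next
    case (Suc j)
    have odd: "hermite_rec_coeff z (Suc (2 * j)) = 2 * of_nat j + 1 + z"
      and even: "hermite_rec_coeff z (Suc (Suc (2 * j))) = 2 * of_nat j + 2"
      by (simp_all add: hermite_rec_coeff_def)
    have step: "gauss_moment (z + of_nat (2 * Suc l)) = (z + 2 * of_nat l + 1) * gauss_moment (z + of_nat (2 * l))" for l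
      using gauss_moment_add_2 [of "z + of_nat (2 * l)"] z by (simp add: algebra_simps)
    have 1: "?L (2 * l) (Suc (Suc (2 * j))) = even_falling l (Suc j) * gauss_moment (z + of_nat (2 * l))" for l
      using Suc.IH step [of l] by (simp only: rec odd even_falling_Suc) (simp add: algebra_simps)
    have 2: "?L (Suc (2 * l)) (Suc (Suc (2 * j))) = 0" for l
      using Suc.IH [rule_format, of l] Suc.IH [rule_format, of "Suc l"] by (simp only: rec) simp
    have 3: "?L (Suc (2 * l)) (Suc (Suc (Suc (2 * j)))) = even_falling l (Suc j) * gauss_moment (z + of_nat (2 * Suc l))" for l
    proof -
      let ?m = "gauss_moment (z + of_nat (2 * Suc l))"
      have "?L (Suc (2 * l)) (Suc (Suc (Suc (2 * j)))) =
          ?L (2 * Suc l) (Suc (Suc (2 * j))) - (2 * of_nat j + 2) * ?L (Suc (2 * l)) (Suc (2 * j))"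
        by (simp only: rec [of _ "Suc _"] even mult_Suc_right add_2_eq_Suc)
      also have "\<dots> = even_falling (Suc l) (Suc j) * ?m - (2 * of_nat j + 2) * (even_falling l j * ?m)"
        using Suc.IH by (simp only: 1)
      also have "\<dots> = even_falling l (Suc j) * ?m"
        unfolding even_falling_Suc_Suc unfolding even_falling_Suc by (simp add: algebra_simps)
      finally show ?thesis .
    qed
    have 4: "?L (2 * l) (Suc (Suc (Suc (2 * j)))) = 0" for l
      using Suc.IH [rule_format, of l] 2 [of l]
      by (simp only: rec [of _ "Suc _"]) simp
    from 1 2 3 4 show ?case by simp
  qed
  then show "?L (2 * l) (2 * j) = even_falling l j * gauss_moment (z + of_nat (2 * l))"
    "?L (Suc (2 * l)) (2 * j) = 0"
    "?L (Suc (2 * l)) (Suc (2 * j)) = even_falling l j * gauss_moment (z + of_nat (2 * Suc l))"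
    "?L (2 * l) (Suc (2 * j)) = 0"
    by blast+
qed

text \<open>
  The value of \<open>gauss_functional z (p\<^sub>k\<^sup>2)\<close>, read off from the pairings above with \<open>a = k\<close>. The first factor is
  free of \<open>z\<close>.
\<close>

definition hermite_norm :: "complex \<Rightarrow> nat \<Rightarrow> complex" where
  "hermite_norm z k = even_falling (k div 2) (k div 2) * gauss_moment (z + of_nat (2 * (Suc k div 2)))"

lemma hermite_norm_nonzero:
  assumes "Re z > - 1"
  shows "hermite_norm z k \<noteq> 0"
  using assms by (simp add: hermite_norm_def even_falling_nonzero gauss_moment_nonzero)

lemma gauss_functional_monom_hermite_le:
  assumes z: "Re z > - 1" and "a \<le> k"
  shows "gauss_functional z (monom 1 a * gen_hermite z k) = (if a = k then hermite_norm z k else 0)"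
proof -
  consider l j where "a = 2 * l" "k = 2 * j" | l j where "a = Suc (2 * l)" "k = 2 * j"
    | l j where "a = Suc (2 * l)" "k = Suc (2 * j)" | l j where "a = 2 * l" "k = Suc (2 * j)"
    by (metis evenE oddE Suc_eq_plus1)
  then show ?thesis
  proof cases
    case 1
    then show ?thesis
      using gauss_functional_monom_hermite(1) [OF z, of l j] \<open>a \<le> k\<close>
      by (cases "l = j") (auto simp: hermite_norm_def even_falling_eq_0)
  next
    case 2
    then show ?thesis
      using gauss_functional_monom_hermite(2) [OF z, of l j] by (auto, presburger)
  next
    case 3
    then show ?thesis
      using gauss_functional_monom_hermite(3) [OF z, of l j] \<open>a \<le> k\<close>
      by (cases "l = j") (auto simp: hermite_norm_def even_falling_eq_0)
  next
    case 4
    then show ?thesis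
      using gauss_functional_monom_hermite(4) [OF z, of l j] by (auto, presburger)
  qed
qed

text \<open>
  The polynomial of lower degree is expanded into monomials; only its leading one pairs nontrivially with the
  other polynomial.
\<close>

lemma gen_hermite_orthogonal:
  assumes z: "Re z > - 1"
  shows "gauss_functional z (gen_hermite z i * gen_hermite z k) = (if i = k then hermite_norm z k else 0)"
proof -
  have le: "gauss_functional z (gen_hermite z i * gen_hermite z k) = (if i = k then hermite_norm z k else 0)"
    if "i \<le> k" for i k
  proof -
    have "gen_hermite z i = (\<Sum>a\<le>i. Polynomial.smult (coeff (gen_hermite z i) a) (monom 1 a))"
      using poly_as_sum_of_monoms' [OF gen_hermite_monic(1), of z i] by (simp add: smult_monom)
    then have "gauss_functional z (gen_hermite z i * gen_hermite z k) =
      gauss_functional z ((\<Sum>a\<le>i. Polynomial.smult (coeff (gen_hermite z i) a) (monom 1 a)) * gen_hermite z k)"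
      by simp
    also have "\<dots> = (\<Sum>a\<le>i. coeff (gen_hermite z i) a * gauss_functional z (monom 1 a * gen_hermite z k))"
      by (simp add: sum_distrib_right gauss_functional_sum [OF z] gauss_functional_smult)
    also have "\<dots> = (\<Sum>a\<le>i. if a = k then hermite_norm z k else 0)"
      using that gen_hermite_monic(2) [of z k]
      by (intro sum.cong refl) (auto simp: gauss_functional_monom_hermite_le [OF z])
    also have "\<dots> = (if i = k then hermite_norm z k else 0)"
      using that by (subst sum.delta) auto
    finally show ?thesis .
  qed
  show ?thesis
    using le [of i k] le [of k i] by (cases "i \<le> k") (auto simp: mult.commute)
qed

section \<open>Eigenvalues of Hermitian matrices\<close>

lemma mat_adjoint_index:
  assumes "A \<in> carrier_mat n n" "i < n" "j < n"
  shows "mat_adjoint A $$ (i, j) = conjugate (A $$ (j, i))"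
  using assms by (simp add: mat_adjoint_def mat_of_rows_index)

lemma hermitian_index:
  fixes A :: "complex mat"
  assumes "A \<in> carrier_mat n n" "mat_adjoint A = A" "i < n" "j < n"
  shows "A $$ (i, j) = cnj (A $$ (j, i))"
  using mat_adjoint_index [OF assms(1,3,4)] assms(2) by simp

text \<open>
  For an eigenvector \<open>v\<close>, the quadratic form \<open>v\<^sup>* A v\<close> is real by symmetry and equals \<open>e \<bar>v\<bar>\<^sup>2\<close>.
\<close>

lemma hermitian_eigenvalue_real:
  fixes A :: "complex mat"
  assumes A: "A \<in> carrier_mat n n" and herm: "mat_adjoint A = A" and ev: "eigenvalue A e"
  shows "e \<in> \<real>"
proof -
  obtain v where v: "v \<in> carrier_vec n" "v \<noteq> 0\<^sub>v n" and Av: "A *\<^sub>v v = e \<cdot>\<^sub>v v"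
    using ev A by (auto simp: eigenvalue_def eigenvector_def)
  define s where "s = (\<Sum>i<n. (cmod (vec_index v i))\<^sup>2)"
  define q where "q = (\<Sum>i<n. \<Sum>j<n. cnj (vec_index v i) * A $$ (i, j) * vec_index v j)"
  have "(\<Sum>j<n. A $$ (i, j) * vec_index v j) = e * vec_index v i" if "i < n" for i
  proof -
    have "vec_index (A *\<^sub>v v) i = (\<Sum>j<n. A $$ (i, j) * vec_index v j)"
      using A v that by (simp add: scalar_prod_def lessThan_atLeast0)
    then show ?thesis using Av v that by simp
  qed
  then have "q = (\<Sum>i<n. cnj (vec_index v i) * (e * vec_index v i))"
    unfolding q_def by (intro sum.cong refl) (simp add: mult.assoc flip: sum_distrib_left)
  also have "\<dots> = e * of_real s"
    unfolding s_def of_real_sum sum_distrib_left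
    by (intro sum.cong refl) (simp add: complex_norm_square mult_ac del: of_real_power)
  finally have q: "q = e * of_real s" .
  have "cnj q = (\<Sum>i<n. \<Sum>j<n. cnj (vec_index v j) * A $$ (j, i) * vec_index v i)"
    unfolding q_def cnj_sum
    by (intro sum.cong refl, subst hermitian_index [OF A herm]) (auto simp: mult_ac)
  also have "\<dots> = q"
    unfolding q_def by (rule sum.swap)
  finally have "q \<in> \<real>"
    by (simp add: Reals_cnj_iff)
  obtain i where "i < n" "vec_index v i \<noteq> 0"
    using v by (metis carrier_vecD eq_vecI index_zero_vec)
  then have "s > 0"
    unfolding s_def by (intro sum_pos2 [of _ i]) auto
  then have "e = q / of_real s"
    using q by simp
  then show ?thesis
    using \<open>q \<in> \<real>\<close> by simp
qed

text \<open>
  The characteristic polynomial splits over the complex numbers and its roots are real. A sorted list is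
  determined by the multiset of its entries, hence by the polynomial, so the definite description denotes.
\<close>

lemma hermitian_sorted_eigenvalues:
  fixes A :: "complex mat"
  assumes A: "A \<in> carrier_mat n n" and herm: "mat_adjoint A = A"
  shows "length (sorted_eigenvalues A) = n"
    and "char_poly A = (\<Prod>x\<leftarrow>sorted_eigenvalues A. [:- complex_of_real x, 1:])"
proof -
  obtain as where as: "char_poly A = (\<Prod>a\<leftarrow>as. [:- a, 1:])" "length as = n"
    using char_poly_factorized [OF A] by blast
  have real: "a \<in> \<real>" if "a \<in> set as" for a
  proof -
    have "poly (char_poly A) a = 0"
      using that unfolding as(1) poly_prod_list prod_list_zero_iff by auto
    then show ?thesis
      using hermitian_eigenvalue_real [OF A herm] eigenvalue_root_char_poly [OF A] by blast
  qed
  define ys where "ys = sort (map Re as)"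
  have char: "char_poly A = (\<Prod>x\<leftarrow>ys. [:- complex_of_real x, 1:])"
  proof -
    have "mset (map complex_of_real ys) = mset (map (\<lambda>a. of_real (Re a)) as)"
      by (simp add: ys_def multiset.map_comp o_def)
    also have "map (\<lambda>a. complex_of_real (Re a)) as = as"
      using real by (intro map_idI) (metis Re_complex_of_real Reals_cases)
    finally have "mset (map (\<lambda>a. [:- a, 1:]) (map complex_of_real ys)) = mset (map (\<lambda>a. [:- a, 1:]) as)"
      by (simp only: mset_map)
    then have "prod_list (map (\<lambda>a. [:- a, 1:]) (map complex_of_real ys)) = prod_list (map (\<lambda>a. [:- a, 1:]) as)"
      by (simp only: flip: prod_mset_prod_list)
    then show ?thesis
      unfolding as(1) by (simp add: o_def)
  qed
  have unique: "xs = ys" if "sorted xs" "char_poly A = (\<Prod>x\<leftarrow>xs. [:- complex_of_real x, 1:])" for xs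
  proof -
    have *: "proots (\<Prod>x\<leftarrow>zs. [:- complex_of_real x, 1:]) = image_mset of_real (mset zs)" for zs
    proof (induction zs)
      case (Cons z zs)
      have "(\<Prod>x\<leftarrow>zs. [:- complex_of_real x, 1:]) \<noteq> 0"
        by (auto simp: prod_list_zero_iff)
      then show ?case
        using Cons by (simp add: proots_mult del: mult_pCons_left)
    qed simp
    have "image_mset complex_of_real (mset xs) = image_mset of_real (mset ys)"
      using that(2) unfolding char * [symmetric] by (rule arg_cong [OF sym])
    then have "image_mset Re (image_mset complex_of_real (mset xs)) = image_mset Re (image_mset complex_of_real (mset ys))"
      by simp
    then have "mset xs = mset ys"
      by (simp add: multiset.map_comp o_def)
    then show ?thesis
      using that(1) by (metis properties_for_sort sorted_sort sort_key_id_if_sorted ys_def)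
  qed
  have eq: "sorted_eigenvalues A = ys"
    unfolding sorted_eigenvalues_def
  proof (rule the_equality)
    show "sorted ys \<and> char_poly A = (\<Prod>x\<leftarrow>ys. [:- complex_of_real x, 1:])"
      using char by (simp add: ys_def)
  qed (use unique in blast)
  show "length (sorted_eigenvalues A) = n"
    unfolding eq by (simp add: ys_def as(2))
  show "char_poly A = (\<Prod>x\<leftarrow>sorted_eigenvalues A. [:- complex_of_real x, 1:])"
    unfolding eq by (rule char)
qed

text \<open>
  Evaluation of the characteristic polynomial at zero. The permutation is present because a joint density of
  unordered eigenvalues concerns a randomly permuted list.
\<close>

lemma hermitian_norm_det:
  fixes A :: "complex mat"
  assumes A: "A \<in> carrier_mat n n" and herm: "mat_adjoint A = A" and p: "p permutes {..<n}"
  shows "cmod (Determinant.det A) = (\<Prod>i<n. \<bar>sorted_eigenvalues A ! p i\<bar>)"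
proof -
  define xs where "xs = sorted_eigenvalues A"
  have "- char_matrix A 0 = (-1) \<cdot>\<^sub>m A"
    using A by (intro eq_matI) (auto simp: char_matrix_def)
  then have "poly (char_poly A) 0 = (-1) ^ n * Determinant.det A"
    using A by (simp add: char_poly_matrix)
  then have "cmod (Determinant.det A) = cmod (poly (char_poly A) 0)"
    by (simp add: norm_mult norm_power)
  also have "\<dots> = (\<Prod>x\<leftarrow>xs. \<bar>x\<bar>)"
    unfolding hermitian_sorted_eigenvalues(2) [OF A herm] poly_prod_list xs_def [symmetric]
    by (induction xs) (auto simp: norm_mult)
  also have "\<dots> = (\<Prod>i<n. \<bar>xs ! i\<bar>)"
    using hermitian_sorted_eigenvalues(1) [OF A herm]
    by (simp add: prod.list_conv_set_nth xs_def lessThan_atLeast0)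
  also have "\<dots> = (\<Prod>i<n. \<bar>xs ! p i\<bar>)"
    by (rule prod.permute [OF p, unfolded o_def])
  finally show ?thesis
    by (simp add: xs_def)
qed

text \<open>
  The determinant is a polynomial in the entries, and every entry is determined by the real coordinates.
\<close>

lemma measurable_hermitian_det:
  fixes W :: "'w \<Rightarrow> complex mat"
  assumes herm: "\<And>\<omega>. \<omega> \<in> space M \<Longrightarrow> W \<omega> \<in> carrier_mat n n \<and> mat_adjoint (W \<omega>) = W \<omega>"
    and coord: "\<And>i j. i < n \<Longrightarrow> j < n \<Longrightarrow> (\<lambda>\<omega>. hermitian_coord (W \<omega>) (i, j)) \<in> borel_measurable M"
  shows "(\<lambda>\<omega>. Determinant.det (W \<omega>)) \<in> borel_measurable M"
proof -
  have upper: "(\<lambda>\<omega>. W \<omega> $$ (i, j)) \<in> borel_measurable M" if "i \<le> j" "j < n" for i j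
  proof -
    have "W \<omega> $$ (i, j) = Complex (hermitian_coord (W \<omega>) (i, j))
        (if i = j then 0 else hermitian_coord (W \<omega>) (j, i))" if "\<omega> \<in> space M" for \<omega>
    proof (cases "i = j")
      case True
      then have "Im (W \<omega> $$ (i, j)) = - Im (W \<omega> $$ (i, j))"
        using hermitian_index [of "W \<omega>" n i j] herm [OF that] \<open>j < n\<close> by (metis cnj.simps(2))
      then show ?thesis
        using True by (simp add: hermitian_coord_def complex_eq_iff)
    next
      case False
      then show ?thesis
        using \<open>i \<le> j\<close> by (simp add: hermitian_coord_def complex_eq_iff)
    qed
    moreover have "(\<lambda>\<omega>. Complex (hermitian_coord (W \<omega>) (i, j))
        (if i = j then 0 else hermitian_coord (W \<omega>) (j, i))) \<in> borel_measurable M"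
      using that coord unfolding Complex_eq by (cases "i = j") simp_all
    ultimately show ?thesis
      by (simp cong: measurable_cong)
  qed
  have entry: "(\<lambda>\<omega>. W \<omega> $$ (i, j)) \<in> borel_measurable M" if "i < n" "j < n" for i j
  proof (cases "i \<le> j")
    case True
    then show ?thesis using upper that by blast
  next
    case False
    have "(\<lambda>\<omega>. cnj (W \<omega> $$ (j, i))) \<in> borel_measurable M"
      using that False
      by (intro measurable_compose [OF upper, of j i cnj] borel_measurable_continuous_onI continuous_intros) auto
    moreover have "W \<omega> $$ (i, j) = cnj (W \<omega> $$ (j, i))" if "\<omega> \<in> space M" for \<omega>
      using hermitian_index [of "W \<omega>" n i j] herm [OF that] \<open>i < n\<close> \<open>j < n\<close> by blast
    ultimately show ?thesis
      by (simp cong: measurable_cong)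
  qed
  have "(\<lambda>\<omega>. \<Sum>p | p permutes {0..<n}. signof p * (\<Prod>i = 0..<n. W \<omega> $$ (i, p i))) \<in> borel_measurable M"
    by (intro borel_measurable_sum borel_measurable_times borel_measurable_prod borel_measurable_const entry)
      (simp_all add: permutes_in_image)
  moreover have "Determinant.det (W \<omega>) = (\<Sum>p | p permutes {0..<n}. signof p * (\<Prod>i = 0..<n. W \<omega> $$ (i, p i)))"
    if "\<omega> \<in> space M" for \<omega>
    using herm [OF that] by (intro det_def') auto
  ultimately show ?thesis
    by (simp cong: measurable_cong)
qed

section \<open>Moments of the GUE determinant\<close>

text \<open>
  Orthogonality kills every pair of distinct permutations, since these differ at some index.
\<close>

lemma sum_permutations_orthogonal:
  fixes h :: "nat \<Rightarrow> 'a :: {comm_ring_1, semiring_char_0}"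
  shows "(\<Sum>\<sigma> | \<sigma> permutes {..<n}. \<Sum>\<tau> | \<tau> permutes {..<n}. of_int (sign \<sigma>) * of_int (sign \<tau>) *
      (\<Prod>i<n. if \<sigma> i = \<tau> i then h (\<tau> i) else 0)) = fact n * (\<Prod>k<n. h k)"
proof -
  have "(\<Sum>\<tau> | \<tau> permutes {..<n}. of_int (sign \<sigma>) * of_int (sign \<tau>) *
      (\<Prod>i<n. if \<sigma> i = \<tau> i then h (\<tau> i) else 0)) = (\<Prod>k<n. h k)" if \<sigma>: "\<sigma> permutes {..<n}" for \<sigma>
  proof -
    have zero: "(\<Prod>i<n. if \<sigma> i = \<tau> i then h (\<tau> i) else 0) = 0" if "\<tau> permutes {..<n}" "\<tau> \<noteq> \<sigma>" for \<tau>
    proof -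
      have "\<exists>i<n. \<sigma> i \<noteq> \<tau> i"
        using that \<sigma> by (metis ext lessThan_iff permutes_not_in)
      then show ?thesis
        by (intro prod_zero) auto
    qed
    have "(\<Sum>\<tau> | \<tau> permutes {..<n}. of_int (sign \<sigma>) * of_int (sign \<tau>) *
        (\<Prod>i<n. if \<sigma> i = \<tau> i then h (\<tau> i) else 0)) =
      (\<Sum>\<tau>\<in>{\<sigma>}. of_int (sign \<sigma>) * of_int (sign \<tau>) * (\<Prod>i<n. if \<sigma> i = \<tau> i then h (\<tau> i) else 0))"
      using \<sigma> zero by (intro sum.mono_neutral_right) (auto simp: finite_permutations)
    also have "\<dots> = (\<Prod>i<n. h (\<sigma> i))"
      by (simp add: sign_def)
    also have "\<dots> = (\<Prod>k<n. h k)"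
      using prod.permute [OF \<sigma>, of h] by (simp add: o_def)
    finally show ?thesis .
  qed
  then have "(\<Sum>\<sigma> | \<sigma> permutes {..<n}. \<Sum>\<tau> | \<tau> permutes {..<n}. of_int (sign \<sigma>) * of_int (sign \<tau>) *
      (\<Prod>i<n. if \<sigma> i = \<tau> i then h (\<tau> i) else 0)) = of_nat (card {\<sigma>. \<sigma> permutes {..<n}}) * (\<Prod>k<n. h k)"
    by simp
  then show ?thesis
    by (simp add: card_permutations [OF refl])
qed

text \<open>
  Both Vandermonde factors are expanded over permutations in the basis of generalized Hermite polynomials; each
  term is then a product of one-dimensional integrals.
\<close>

lemma vandermonde_gauss_integral:
  assumes z: "Re z > - 1"
  shows "has_bochner_integral (\<Pi>\<^sub>M i\<in>{..<n}. lborel)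
    (\<lambda>l. (\<Prod>k<n. \<Prod>j<k. complex_of_real (l k) - complex_of_real (l j))\<^sup>2 * (\<Prod>i<n. gauss_weight z (l i)))
    (fact n * (\<Prod>k<n. hermite_norm z k))"
proof -
  interpret product_sigma_finite "\<lambda>_::nat. lborel :: real measure"
    by standard
  let ?p = "gen_hermite z"
  let ?S = "{\<sigma>. \<sigma> permutes {..<n}}"
  let ?F = "\<lambda>\<sigma> \<tau> i x. poly (?p (\<sigma> i) * ?p (\<tau> i)) (complex_of_real x) * gauss_weight z x"
  have "has_bochner_integral (\<Pi>\<^sub>M i\<in>{..<n}. lborel) (\<lambda>l. \<Prod>i<n. ?F \<sigma> \<tau> i (l i))
      (\<Prod>i<n. if \<sigma> i = \<tau> i then hermite_norm z (\<tau> i) else 0)" for \<sigma> \<tau>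
    unfolding has_bochner_integral_iff
    by (subst product_integral_prod; (intro conjI product_integrable_prod)?)
      (auto simp: gen_hermite_orthogonal [OF z, symmetric] gauss_functional_def
        intro!: integrable_poly_gauss_weight [OF z] simp del: poly_mult)
  then have "has_bochner_integral (\<Pi>\<^sub>M i\<in>{..<n}. lborel)
      (\<lambda>l. \<Sum>\<sigma>\<in>?S. \<Sum>\<tau>\<in>?S. of_int (sign \<sigma>) * of_int (sign \<tau>) * (\<Prod>i<n. ?F \<sigma> \<tau> i (l i)))
      (\<Sum>\<sigma>\<in>?S. \<Sum>\<tau>\<in>?S. of_int (sign \<sigma>) * of_int (sign \<tau>) *
        (\<Prod>i<n. if \<sigma> i = \<tau> i then hermite_norm z (\<tau> i) else 0))"
    by (intro has_bochner_integral_sum has_bochner_integral_mult_right)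
  also have "(\<lambda>l. \<Sum>\<sigma>\<in>?S. \<Sum>\<tau>\<in>?S. of_int (sign \<sigma>) * of_int (sign \<tau>) * (\<Prod>i<n. ?F \<sigma> \<tau> i (l i))) =
    (\<lambda>l. (\<Prod>k<n. \<Prod>j<k. complex_of_real (l k) - complex_of_real (l j))\<^sup>2 * (\<Prod>i<n. gauss_weight z (l i)))"
  proof
    fix l :: "nat \<Rightarrow> real"
    have "(\<Prod>k<n. \<Prod>j<k. complex_of_real (l k) - complex_of_real (l j)) =
      (\<Sum>\<sigma>\<in>?S. of_int (sign \<sigma>) * (\<Prod>i<n. poly (?p (\<sigma> i)) (complex_of_real (l i))))"
      by (rule vandermonde_sum_permutations) (auto simp: gen_hermite_monic)
    then show "(\<Sum>\<sigma>\<in>?S. \<Sum>\<tau>\<in>?S. of_int (sign \<sigma>) * of_int (sign \<tau>) * (\<Prod>i<n. ?F \<sigma> \<tau> i (l i))) =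
      (\<Prod>k<n. \<Prod>j<k. complex_of_real (l k) - complex_of_real (l j))\<^sup>2 * (\<Prod>i<n. gauss_weight z (l i))"
      by (simp add: power2_eq_square sum_product sum_distrib_right sum_distrib_left prod.distrib mult_ac)
  qed
  finally show ?thesis
    unfolding sum_permutations_orthogonal .
qed

lemma AE_PiM_lborel_nonzero:
  assumes "finite I"
  shows "AE l in (\<Pi>\<^sub>M i\<in>I. lborel :: real measure). \<forall>i\<in>I. l i \<noteq> 0"
proof -
  interpret product_sigma_finite "\<lambda>_. lborel :: real measure"
    by standard
  have "AE l in (\<Pi>\<^sub>M i\<in>I. lborel :: real measure). l i \<noteq> 0" if "i \<in> I" for i
  proof (rule AE_I)
    let ?N = "\<Pi>\<^sub>E j\<in>I. if j = i then {0} else UNIV :: real set"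
    show "{l \<in> space (\<Pi>\<^sub>M i\<in>I. lborel). \<not> l i \<noteq> 0} \<subseteq> ?N"
      by (auto simp: space_PiM PiE_iff extensional_def)
    show "emeasure (\<Pi>\<^sub>M i\<in>I. lborel) ?N = 0"
      using assms that by (subst emeasure_PiM) (auto intro!: prod_zero bexI [of _ i])
    show "?N \<in> sets (\<Pi>\<^sub>M i\<in>I. lborel)"
      using assms by (intro sets_PiM_I_finite) auto
  qed
  then show ?thesis
    using assms by (simp add: AE_finite_all)
qed

text \<open>
  A statistic that does not depend on the order of the eigenvalues can be integrated over the product with the
  uniform permutation, where the joint density is available.
\<close>

lemma eigenvalue_statistic_expectation:
  fixes g :: "(nat \<Rightarrow> real) \<Rightarrow> complex" and G :: "'w \<Rightarrow> complex"
  assumes M: "prob_space M" and dens: "has_eigenvalue_density n M W f" and f: "\<And>l. f l \<ge> 0"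
    and f_meas: "f \<in> borel_measurable (\<Pi>\<^sub>M i\<in>{..<n}. lborel)"
    and g: "g \<in> borel_measurable (\<Pi>\<^sub>M i\<in>{..<n}. lborel)"
    and G: "G \<in> borel_measurable M"
    and eq: "\<And>\<omega> p. \<omega> \<in> space M \<Longrightarrow> p permutes {..<n} \<Longrightarrow>
      g (\<lambda>i\<in>{..<n}. sorted_eigenvalues (W \<omega>) ! p i) = G \<omega>"
    and int: "has_bochner_integral (\<Pi>\<^sub>M i\<in>{..<n}. lborel) (\<lambda>l. f l *\<^sub>R g l) c"
  shows "has_bochner_integral M G c"
proof -
  let ?U = "uniform_count_measure {p. p permutes {..<n}}"
  let ?P = "\<Pi>\<^sub>M i\<in>{..<n}. lborel :: real measure"
  let ?T = "\<lambda>(\<omega>, p). \<lambda>i\<in>{..<n}. sorted_eigenvalues (W \<omega>) ! p i"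
  interpret M: prob_space M by (rule M)
  have "{p. p permutes {..<n}} \<noteq> {}"
    using permutes_id by blast
  then interpret U: prob_space ?U
    by (intro prob_space_uniform_count_measure) (auto simp: finite_permutations)
  interpret MU: pair_prob_space M ?U ..
  have D: "distributed (M \<Otimes>\<^sub>M ?U) ?P ?T (\<lambda>l. ennreal (f l))"
    using dens by (simp add: has_eigenvalue_density_def)
  note [measurable] = distributed_measurable [OF D] g G f_meas
  have "has_bochner_integral (density ?P (\<lambda>l. ennreal (f l))) g c"
    using int f by (simp add: has_bochner_integral_iff integrable_density integral_density)
  then have "has_bochner_integral (distr (M \<Otimes>\<^sub>M ?U) ?P ?T) g c"
    by (simp add: distributed_distr_eq_density [OF D])
  then have "has_bochner_integral (M \<Otimes>\<^sub>M ?U) (\<lambda>x. g (?T x)) c"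
    by (simp add: has_bochner_integral_iff integrable_distr_eq integral_distr)
  moreover have "g (?T x) = G (fst x)" if "x \<in> space (M \<Otimes>\<^sub>M ?U)" for x
    using that eq by (auto simp: space_pair_measure space_uniform_count_measure)
  ultimately have "has_bochner_integral (M \<Otimes>\<^sub>M ?U) (\<lambda>x. G (fst x)) c"
    by (simp cong: has_bochner_integral_cong)
  then have "has_bochner_integral (distr (M \<Otimes>\<^sub>M ?U) M fst) G c"
    by (simp add: has_bochner_integral_iff integrable_distr_eq integral_distr)
  then show ?thesis
    by (simp add: U.distr_pair_fst)
qed

lemma normalized_GUE_basic:
  fixes W :: "'w \<Rightarrow> complex mat"
  assumes "is_normalized_GUE n M W"
  shows "prob_space M" and "\<And>\<omega>. \<omega> \<in> space M \<Longrightarrow> W \<omega> \<in> carrier_mat n n \<and> mat_adjoint (W \<omega>) = W \<omega>"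
    and "(\<lambda>\<omega>. Determinant.det (W \<omega>)) \<in> borel_measurable M"
proof -
  obtain \<sigma> where "is_GUE n \<sigma> M W"
    using assms by (auto simp: is_normalized_GUE_def)
  then show "prob_space M"
    and herm: "\<And>\<omega>. \<omega> \<in> space M \<Longrightarrow> W \<omega> \<in> carrier_mat n n \<and> mat_adjoint (W \<omega>) = W \<omega>"
    by (auto simp: is_GUE_def)
  have "\<And>i j. i < n \<Longrightarrow> j < n \<Longrightarrow> \<exists>f. distributed M lborel (\<lambda>\<omega>. hermitian_coord (W \<omega>) (i, j)) f"
    using \<open>is_GUE n \<sigma> M W\<close> by (auto simp: is_GUE_def)
  then have coord: "(\<lambda>\<omega>. hermitian_coord (W \<omega>) (i, j)) \<in> borel_measurable M" if "i < n" "j < n" for i j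
    using that distributed_measurable by (metis measurable_lborel1)
  show "(\<lambda>\<omega>. Determinant.det (W \<omega>)) \<in> borel_measurable M"
    by (rule measurable_hermitian_det [OF herm coord])
qed

text \<open>
  The normalization constant of the eigenvalue density is eliminated by comparison with the case \<open>z = 0\<close>, in
  which the expectation is 1.
\<close>

lemma GUE_det_moment:
  fixes W :: "'w \<Rightarrow> complex mat"
  assumes GUE: "is_normalized_GUE n M W" and z: "Re z > - 1"
  shows "has_bochner_integral M (\<lambda>\<omega>. exp (z * complex_of_real (ln (cmod (Determinant.det (W \<omega>))))))
    (\<Prod>k<n. hermite_norm z k / hermite_norm 0 k)"
proof -
  note M = normalized_GUE_basic(1) [OF GUE] and herm = normalized_GUE_basic(2) [OF GUE]
  let ?P = "\<Pi>\<^sub>M i\<in>{..<n}. lborel :: real measure"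
  define v where "v = (\<lambda>l :: nat \<Rightarrow> real. (\<Prod>k<n. \<Prod>j<k. \<bar>l k - l j\<bar>\<^sup>2) * (\<Prod>k<n. exp (- ((l k)\<^sup>2 / 2))))"
  obtain C where C: "C > 0" and dens: "has_eigenvalue_density n M W (\<lambda>l. C * v l)"
    using GUE by (auto simp: is_normalized_GUE_def v_def)
  have [measurable]: "v \<in> borel_measurable ?P"
    unfolding v_def by measurable
  have v: "v l \<ge> 0" for l
    unfolding v_def by (intro mult_nonneg_nonneg prod_nonneg) auto
  note [measurable] = normalized_GUE_basic(3) [OF GUE]
  define c where "c = (\<lambda>z. complex_of_real C * (fact n * (\<Prod>k<n. hermite_norm z k)))"
  have *: "has_bochner_integral M (\<lambda>\<omega>. exp (z * complex_of_real (ln (cmod (Determinant.det (W \<omega>)))))) (c z)"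
    if z: "Re z > - 1" for z
  proof (rule eigenvalue_statistic_expectation [OF M dens])
    let ?g = "\<lambda>l. exp (z * complex_of_real (ln (\<Prod>i<n. \<bar>l i\<bar>)))"
    show "?g \<in> borel_measurable ?P"
      by measurable
    show "?g (\<lambda>i\<in>{..<n}. sorted_eigenvalues (W \<omega>) ! p i) =
        exp (z * complex_of_real (ln (cmod (Determinant.det (W \<omega>)))))"
      if "\<omega> \<in> space M" "p permutes {..<n}" for \<omega> p
      using hermitian_norm_det [of "W \<omega>" n p] herm [OF that(1)] that(2) by simp
    have "(C * v l) *\<^sub>R ?g l = of_real C * ((\<Prod>k<n. \<Prod>j<k. complex_of_real (l k) - complex_of_real (l j))\<^sup>2 *
        (\<Prod>i<n. gauss_weight z (l i)))" if "\<forall>i\<in>{..<n}. l i \<noteq> 0" for l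
    proof -
      have "?g l = (\<Prod>i<n. exp (z * complex_of_real (ln \<bar>l i\<bar>)))"
        using that by (subst ln_prod) (auto simp: sum_distrib_left exp_sum)
      moreover have "complex_of_real (\<Prod>k<n. \<Prod>j<k. \<bar>l k - l j\<bar>\<^sup>2) = (\<Prod>k<n. \<Prod>j<k. complex_of_real (l k) - complex_of_real (l j))\<^sup>2"
        by (simp add: prod_power_distrib)
      ultimately show ?thesis
        by (simp add: scaleR_conv_of_real v_def gauss_weight_def prod.distrib mult_ac)
    qed
    \<comment> \<open>A vanishing eigenvalue is excluded because \<open>ln 0 = 0\<close> is not compatible with the logarithm of a product.\<close>
    then have "AE l in ?P. (C * v l) *\<^sub>R ?g l =
        of_real C * ((\<Prod>k<n. \<Prod>j<k. complex_of_real (l k) - complex_of_real (l j))\<^sup>2 * (\<Prod>i<n. gauss_weight z (l i)))"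
      using AE_PiM_lborel_nonzero [of "{..<n}"] by (auto elim: eventually_mono)
    moreover have "has_bochner_integral ?P (\<lambda>l. of_real C * ((\<Prod>k<n. \<Prod>j<k. complex_of_real (l k) - complex_of_real (l j))\<^sup>2 *
        (\<Prod>i<n. gauss_weight z (l i)))) (c z)"
      unfolding c_def by (intro has_bochner_integral_mult_right vandermonde_gauss_integral z)
    ultimately show "has_bochner_integral ?P (\<lambda>l. (C * v l) *\<^sub>R ?g l) (c z)"
      by (subst has_bochner_integral_cong_AE) auto
  qed (use C v in auto)
  have "has_bochner_integral M (\<lambda>\<omega>. 1 :: complex) (c 0)"
    using * [of 0] by simp
  then have "c 0 = 1"
    using prob_space.prob_space [OF M] by (simp add: has_bochner_integral_iff)
  moreover have "c 0 \<noteq> 0"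
    using C by (simp add: c_def hermite_norm_nonzero)
  ultimately have "c z = c z / c 0"
    by simp
  also have "\<dots> = (\<Prod>k<n. hermite_norm z k / hermite_norm 0 k)"
    using C by (simp add: c_def prod_dividef)
  finally show ?thesis
    using * [OF z] by simp
qed

section \<open>The logarithm of the Barnes product\<close>

text \<open>
  The tail of the logarithmic series from the cubic term on is dominated by a geometric series.
\<close>

lemma Ln_approx_quadratic:
  fixes u :: complex
  assumes "cmod u \<le> 1 / 2"
  shows "cmod (Ln (1 + u) - u + u\<^sup>2 / 2) \<le> 2 * cmod u ^ 3"
proof -
  define f where "f = (\<lambda>n. - ((-u) ^ n) / of_nat n)"
  have "f sums Ln (1 + u)"
    unfolding f_def using assms by (intro Ln_series') simp
  then have "(\<lambda>n. f (n + 3)) sums (Ln (1 + u) - (\<Sum>n<3. f n))"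
    by (rule sums_split_initial_segment)
  also have "Ln (1 + u) - (\<Sum>n<3. f n) = Ln (1 + u) - u + u\<^sup>2 / 2"
    by (simp add: f_def numeral_3_eq_3 power2_eq_square)
  finally have f: "(\<lambda>n. f (n + 3)) sums (Ln (1 + u) - u + u\<^sup>2 / 2)" .
  have g: "(\<lambda>n. cmod u ^ 3 * cmod u ^ n) sums (cmod u ^ 3 * (1 / (1 - cmod u)))"
    using assms by (intro sums_mult geometric_sums) simp
  have "cmod (f (n + 3)) \<le> cmod u ^ 3 * cmod u ^ n" for n
  proof -
    have "cmod (f (n + 3)) = cmod u ^ 3 * cmod u ^ n / real (n + 3)"
      by (simp add: f_def norm_divide norm_power norm_mult power_add mult.commute del: of_nat_add)
    also have "\<dots> \<le> cmod u ^ 3 * cmod u ^ n / 1"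
      by (intro divide_left_mono) auto
    finally show ?thesis by simp
  qed
  then have "cmod (Ln (1 + u) - u + u\<^sup>2 / 2) \<le> cmod u ^ 3 * (1 / (1 - cmod u))"
    using norm_suminf_le [of "\<lambda>n. f (n + 3)"] f g by (metis sums_unique sums_summable)
  also have "\<dots> \<le> cmod u ^ 3 * 2"
    using assms by (intro mult_left_mono) (auto simp: field_simps)
  finally show ?thesis by simp
qed

text \<open>
  A logarithm of the factor number \<open>j + 1\<close> of the product for \<open>G (1 + w)\<close>. On the half-plane \<open>Re w > - 1\<close> the principal
  branch applies to every factor.
\<close>

definition barnes_log_factor :: "complex \<Rightarrow> nat \<Rightarrow> complex" where
  "barnes_log_factor w j = of_nat (Suc j) * Ln (1 + w / of_nat (Suc j)) +
     w\<^sup>2 / 2 * of_real (ln (1 + 1 / real (Suc j))) - w"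

lemma one_plus_divide_not_nonpos:
  assumes "Re w > - 1" "k \<ge> 1"
  shows "1 + w / of_nat k \<notin> \<real>\<^sub>\<le>\<^sub>0"
proof -
  have "Re (w / of_nat k) > - 1"
  proof (cases "Re w \<ge> 0")
    case False
    have "- real k < Re w" using assms by simp
    then show ?thesis using assms by (simp add: field_simps)
  qed (simp add: order_less_le_trans [of _ 0])
  then have "Re (1 + w / of_nat k) > 0" by simp
  then show ?thesis by (auto simp: complex_nonpos_Reals_iff)
qed

lemma exp_barnes_log_factor:
  assumes "Re w > - 1"
  shows "exp (barnes_log_factor w j) = (1 + w / of_nat (Suc j)) ^ Suc j *
    complex_of_real (1 + 1 / real (Suc j)) powr (w\<^sup>2 / 2) * exp (- w)"
proof -
  have "1 + w / of_nat (Suc j) \<noteq> 0"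
    using one_plus_divide_not_nonpos [OF assms, of "Suc j"] by (auto simp del: of_nat_Suc)
  then have "exp (of_nat (Suc j) * Ln (1 + w / of_nat (Suc j))) = (1 + w / of_nat (Suc j)) ^ Suc j"
    by (subst exp_of_nat_mult) (simp del: of_nat_Suc)
  moreover have "exp (w\<^sup>2 / 2 * of_real (ln (1 + 1 / real (Suc j)))) = complex_of_real (1 + 1 / real (Suc j)) powr (w\<^sup>2 / 2)"
  proof -
    have pos: "1 + 1 / real (Suc j) > 0" by (simp add: add_pos_pos)
    then have "complex_of_real (1 + 1 / real (Suc j)) \<noteq> 0"
      by (metis less_irrefl of_real_eq_0_iff)
    then show ?thesis
      unfolding powr_def by (simp only: Ln_of_real [OF pos] if_False)
  qed
  ultimately show ?thesis
    by (simp only: barnes_log_factor_def exp_diff exp_add exp_minus) (simp add: field_simps del: of_nat_Suc)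
qed

text \<open>
  With \<open>k = j + 1\<close> and \<open>E u = Ln (1 + u) - u + u\<^sup>2 / 2\<close> the terms in \<open>w\<close> and \<open>w\<^sup>2 / k\<close> cancel, and what is left is
  \<open>k E (w / k) + (w\<^sup>2 / 2) (E (1 / k) - 1 / (2 k\<^sup>2))\<close>.
\<close>

lemma norm_barnes_log_factor_le:
  assumes R: "cmod w \<le> R" "R \<ge> 1" and j: "2 * R \<le> real (Suc j)"
  shows "cmod (barnes_log_factor w j) \<le> 4 * R ^ 3 / real (Suc j) ^ 2"
proof -
  define k where "k = Suc j"
  have k: "real k \<ge> 2 * R" "real k \<ge> 2" "real k > 0" using j R by (auto simp: k_def)
  define E where "E = (\<lambda>u. Ln (1 + u) - u + u\<^sup>2 / 2)"
  have E1: "cmod (E (w / of_nat k)) \<le> 2 * R ^ 3 / real k ^ 3"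
  proof -
    have "cmod (w / of_nat k) \<le> R / real k"
      using R k by (simp add: norm_divide divide_right_mono)
    moreover have "R / real k \<le> 1 / 2" using k by (simp add: field_simps)
    ultimately have "cmod (E (w / of_nat k)) \<le> 2 * cmod (w / of_nat k) ^ 3"
      unfolding E_def by (intro Ln_approx_quadratic) linarith
    also have "\<dots> \<le> 2 * (R / real k) ^ 3"
      using \<open>cmod (w / of_nat k) \<le> R / real k\<close> by (intro mult_left_mono power_mono) auto
    finally show ?thesis by (simp add: power_divide)
  qed
  have E2: "cmod (E (1 / of_nat k)) \<le> 2 / real k ^ 3"
  proof -
    have "cmod (E (1 / of_nat k)) \<le> 2 * cmod (1 / of_nat k) ^ 3"
      unfolding E_def using k by (intro Ln_approx_quadratic) (simp add: norm_divide field_simps)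
    then show ?thesis by (simp add: norm_divide power_divide)
  qed
  have ln: "complex_of_real (ln (1 + 1 / real k)) = Ln (1 + 1 / of_nat k)"
    using k by (subst Ln_of_real [symmetric]) (auto intro: add_pos_pos)
  have "barnes_log_factor w j = of_nat k * E (w / of_nat k) + w\<^sup>2 / 2 * (E (1 / of_nat k) - 1 / (2 * of_nat k ^ 2))"
    unfolding barnes_log_factor_def k_def [symmetric] ln E_def using k
    by (simp add: field_simps power2_eq_square)
  also have "cmod \<dots> \<le> real k * (2 * R ^ 3 / real k ^ 3) + R\<^sup>2 / 2 * (2 / real k ^ 3 + 1 / (2 * real k ^ 2))"
  proof (intro norm_triangle_mono)
    show "cmod (of_nat k * E (w / of_nat k)) \<le> real k * (2 * R ^ 3 / real k ^ 3)"
      using mult_left_mono [OF E1, of "real k"] by (simp add: norm_mult)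
    have "cmod (E (1 / of_nat k) - 1 / (2 * of_nat k ^ 2)) \<le> 2 / real k ^ 3 + 1 / (2 * real k ^ 2)"
      using E2 by (intro order_trans [OF norm_triangle_ineq4] add_mono) (auto simp: norm_divide norm_mult norm_power)
    then have "cmod (w\<^sup>2 / 2) * cmod (E (1 / of_nat k) - 1 / (2 * of_nat k ^ 2)) \<le>
        R\<^sup>2 / 2 * (2 / real k ^ 3 + 1 / (2 * real k ^ 2))"
      using R by (intro mult_mono) (auto simp: norm_divide norm_power intro!: divide_right_mono power_mono)
    then show "cmod (w\<^sup>2 / 2 * (E (1 / of_nat k) - 1 / (2 * of_nat k ^ 2))) \<le>
        R\<^sup>2 / 2 * (2 / real k ^ 3 + 1 / (2 * real k ^ 2))"
      by (simp only: norm_mult)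
  qed
  also have "\<dots> \<le> 4 * R ^ 3 / real k ^ 2"
  proof -
    have "2 / real k ^ 3 + 1 / (2 * real k ^ 2) \<le> 2 / real k ^ 2"
      using k by (simp add: field_simps power2_eq_square power3_eq_cube)
    then have "R\<^sup>2 / 2 * (2 / real k ^ 3 + 1 / (2 * real k ^ 2)) \<le> R\<^sup>2 / 2 * (2 / real k ^ 2)"
      by (intro mult_left_mono) auto
    also have "\<dots> \<le> R ^ 3 / real k ^ 2"
      using R by (simp add: divide_right_mono power3_eq_cube power2_eq_square mult_le_cancel_right1)
    finally have "R\<^sup>2 / 2 * (2 / real k ^ 3 + 1 / (2 * real k ^ 2)) \<le> R ^ 3 / real k ^ 2" .
    moreover have "real k * (2 * R ^ 3 / real k ^ 3) = 2 * (R ^ 3 / real k ^ 2)"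
      using k by (simp add: power2_eq_square power3_eq_cube)
    moreover have "R ^ 3 / real k ^ 2 \<ge> 0" "4 * R ^ 3 / real k ^ 2 = 4 * (R ^ 3 / real k ^ 2)"
      using R by simp_all
    ultimately show ?thesis by (smt (verit))
  qed
  finally show ?thesis by (simp add: k_def)
qed

lemma barnes_log_uniform:
  assumes "bounded K"
  shows "uniform_limit K (\<lambda>m w. \<Sum>j<m. barnes_log_factor w j) (\<lambda>w. \<Sum>j. barnes_log_factor w j) sequentially"
proof -
  obtain R0 where R0: "\<And>w. w \<in> K \<Longrightarrow> cmod w \<le> R0"
    using assms by (auto simp: bounded_iff)
  define R where "R = max R0 1"
  have R: "cmod w \<le> R" if "w \<in> K" for w using R0 [OF that] by (simp add: R_def)
  have R1: "R \<ge> 1" by (simp add: R_def)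
  show ?thesis
  proof (rule Weierstrass_m_test_ev)
    show "summable (\<lambda>j. 4 * R ^ 3 / real (Suc j) ^ 2)"
      using summable_mult [OF inverse_squares_sums [THEN sums_summable], of "4 * R ^ 3"] by simp
    have "\<forall>\<^sub>F j in sequentially. 2 * R \<le> real (Suc j)"
      by real_asymp
    then show "\<forall>\<^sub>F j in sequentially. \<forall>w\<in>K. norm (barnes_log_factor w j) \<le> 4 * R ^ 3 / real (Suc j) ^ 2"
      by eventually_elim (auto intro!: norm_barnes_log_factor_le R R1 simp del: of_nat_Suc)
  qed
qed

lemma summable_barnes_log_factor: "summable (barnes_log_factor w)"
proof -
  have "(\<lambda>m. \<Sum>j<m. barnes_log_factor w j) \<longlonglongrightarrow> (\<Sum>j. barnes_log_factor w j)"
    using barnes_log_uniform [of "{w}"] by simp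
  then show ?thesis
    by (auto simp: summable_def sums_def)
qed

text \<open>
  The series of logarithms converges, so the infinite product is the exponential of its sum.
\<close>

lemma barnes_G_eq_exp:
  assumes "Re w > - 1"
  shows "barnes_G (1 + w) = exp (w / 2 * of_real (ln (2 * pi)) - (w + 1) * w / 2 + (\<Sum>j. barnes_log_factor w j))"
proof -
  have "(\<Prod>j. exp (barnes_log_factor w j)) = exp (\<Sum>j. barnes_log_factor w j)"
    by (intro prodinf_exp summable_barnes_log_factor)
  moreover have "complex_of_real (2 * pi) powr (w / 2) = exp (w / 2 * of_real (ln (2 * pi)))"
    by (subst powr_def, subst Ln_of_real) (auto simp: mult_ac)
  moreover have "exp (- ((w + 1) * w / 2)) = inverse (exp ((w + 1) * w / 2))"
    by (rule exp_minus)
  ultimately show ?thesis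
    unfolding barnes_G_def Let_def add_diff_cancel_left' exp_barnes_log_factor [OF assms, symmetric]
    by (simp only: exp_add exp_diff) (simp only: divide_inverse)
qed

section \<open>Quotients of Gamma values\<close>

text \<open>
  The quotient \<open>\<Gamma> (1 + w + k) / \<Gamma> (1 / 2 + k)\<close> divided by its leading behaviour \<open>k\<^sup>w\<^sup>+\<^sup>1\<^sup>/\<^sup>2\<close>.
\<close>

definition gamma_quotient :: "complex \<Rightarrow> nat \<Rightarrow> complex" where
  "gamma_quotient w k = Gamma (1 + w + of_nat k) / Gamma (1 / 2 + of_nat k) * exp (- ((w + 1 / 2) * of_real (ln (real k))))"

text \<open>
  A logarithm of \<open>gamma_quotient w k / gamma_quotient w (k + 1)\<close>; the sign is chosen such that the tail sums of
  these terms are logarithms of the quotient itself, as it tends to 1.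
\<close>

definition gamma_log_factor :: "complex \<Rightarrow> nat \<Rightarrow> complex" where
  "gamma_log_factor w k = (w + 1 / 2) * of_real (ln (1 + 1 / real k)) + of_real (ln (1 + 1 / (2 * real k)))
     - Ln (1 + (1 + w) / of_nat k)"

definition gamma_log_tail :: "complex \<Rightarrow> nat \<Rightarrow> complex" where
  "gamma_log_tail w m = (\<Sum>i. gamma_log_factor w (i + m))"

lemma Gamma_add_of_nat_Suc:
  fixes a :: complex
  assumes "Re a > 0"
  shows "Gamma (a + of_nat (Suc k)) = (a + of_nat k) * Gamma (a + of_nat k)"
  using Gamma_plus1 [of "a + of_nat k"] right_halfplane_not_nonpos_Ints [of "a + of_nat k"] assms
  by (simp add: add_ac)

lemma gamma_quotient_Suc:
  assumes w: "Re w > - 1" and k: "k \<ge> 1"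
  shows "gamma_quotient w (Suc k) = gamma_quotient w k * exp (- gamma_log_factor w k)"
proof -
  have kr: "real k > 0" using k by simp
  have k0: "complex_of_nat k \<noteq> 0" using k by simp
  have "1 + (1 + w) / of_nat k \<noteq> 0"
  proof
    assume "1 + (1 + w) / of_nat k = 0"
    moreover have "1 + w = (1 + (1 + w) / of_nat k) * of_nat k - of_nat k"
      using k0 by (simp add: field_simps)
    ultimately have "1 + w = - of_nat k" by simp
    then have "Re (1 + w) = - real k" by simp
    then show False using w by simp
  qed
  then have 1: "exp (Ln (1 + (1 + w) / of_nat k)) = (1 + w + of_nat k) / of_nat k"
    using k0 by (simp add: field_simps)
  have 2: "exp (complex_of_real (ln (1 + 1 / (2 * real k)))) = (1 / 2 + of_nat k) / of_nat k"
    using kr k0 by (subst exp_of_real, subst exp_ln) (auto intro: add_pos_pos simp: field_simps)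
  have 3: "ln (real (Suc k)) = ln (real k) + ln (1 + 1 / real k)"
  proof -
    have "real (Suc k) = real k * (1 + 1 / real k)"
      using kr by (simp add: field_simps)
    moreover have "1 + 1 / real k > 0"
      using kr by (auto intro: add_pos_pos)
    ultimately show ?thesis
      using kr by (simp only: ln_mult_pos)
  qed
  have 4: "Gamma (1 + w + of_nat (Suc k)) = (1 + w + of_nat k) * Gamma (1 + w + of_nat k)"
    "Gamma (1 / 2 + complex_of_nat (Suc k)) = (1 / 2 + of_nat k) * Gamma (1 / 2 + of_nat k)"
    using w Gamma_add_of_nat_Suc [of "1 + w" k] Gamma_add_of_nat_Suc [of "1 / 2" k]
    by (simp_all del: of_nat_Suc)
  have 5: "exp (- ((w + 1 / 2) * of_real (ln (real k) + ln (1 + 1 / real k)))) =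
      exp (- ((w + 1 / 2) * of_real (ln (real k)))) * exp (- ((w + 1 / 2) * of_real (ln (1 + 1 / real k))))"
    by (simp add: algebra_simps flip: exp_add)
  have "gamma_quotient w (Suc k) =
      ((1 + w + of_nat k) * Gamma (1 + w + of_nat k)) / ((1 / 2 + of_nat k) * Gamma (1 / 2 + of_nat k)) *
      (exp (- ((w + 1 / 2) * of_real (ln (real k)))) * exp (- ((w + 1 / 2) * of_real (ln (1 + 1 / real k)))))"
    unfolding gamma_quotient_def 3 4 5 by (rule refl)
  moreover have "exp (- gamma_log_factor w k) =
      exp (- ((w + 1 / 2) * of_real (ln (1 + 1 / real k)))) * ((1 + w + of_nat k) / (1 / 2 + of_nat k))"
  proof -
    have "- gamma_log_factor w k = - ((w + 1 / 2) * of_real (ln (1 + 1 / real k))) +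
       (Ln (1 + (1 + w) / of_nat k) - of_real (ln (1 + 1 / (2 * real k))))"
      by (simp add: gamma_log_factor_def)
    then show ?thesis
      unfolding exp_add exp_diff 1 2 using k0 by (simp only: exp_add exp_diff 1 2) simp
  qed
  moreover have "(A * B) / (C * D) * (P * Q) = B / D * P * (Q * (A / C))" for A B C D P Q :: complex
    by (simp add: divide_inverse mult_ac)
  ultimately show ?thesis
    by (simp only: gamma_quotient_def [of w k])
qed

text \<open>
  Both Gamma values are compared with Gauss's limit \<open>n! n\<^sup>a / (a (a + 1) \<dots> (a + n))\<close>. The last factor accounts for
  the shift between \<open>n\<close> and \<open>n + 1\<close> in the power.
\<close>

lemma gamma_quotient_tendsto_1:
  assumes w: "Re w > - 1"
  shows "gamma_quotient w \<longlonglongrightarrow> 1"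
proof -
  define g where "g = (\<lambda>(a :: complex) n. Gamma (a + of_nat (Suc n)) / (fact n * exp (a * of_real (ln (real n)))))"
  have g: "g a \<longlonglongrightarrow> 1" if "Re a > 0" for a
  proof -
    have nz: "a \<notin> \<int>\<^sub>\<le>\<^sub>0" by (rule right_halfplane_not_nonpos_Ints [OF that])
    then have "(\<lambda>n. Gamma a / Gamma_series a n) \<longlonglongrightarrow> Gamma a / Gamma a"
      by (intro tendsto_intros) (simp_all add: Gamma_eq_zero_iff)
    moreover have "g a = (\<lambda>n. Gamma a / Gamma_series a n)"
      using pochhammer_Gamma [OF nz, of "Suc _"] nz
      by (auto simp: g_def Gamma_series_def Gamma_eq_zero_iff fun_eq_iff)
    ultimately show ?thesis using nz by (simp add: Gamma_eq_zero_iff)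
  qed
  have "(\<lambda>n. exp (- ((w + 1 / 2) * of_real (ln (real (Suc n)) - ln (real n))))) \<longlonglongrightarrow> exp (- ((w + 1 / 2) * of_real 0))"
    by (intro tendsto_intros) real_asymp
  then have "(\<lambda>n. g (1 + w) n / g (1 / 2) n * exp (- ((w + 1 / 2) * of_real (ln (real (Suc n)) - ln (real n))))) \<longlonglongrightarrow> 1 / 1 * 1"
    using w by (intro tendsto_mult tendsto_divide g) auto
  moreover have "gamma_quotient w (Suc n) =
      g (1 + w) n / g (1 / 2) n * exp (- ((w + 1 / 2) * of_real (ln (real (Suc n)) - ln (real n))))" for n
  proof -
    have "exp (- ((w + 1 / 2) * complex_of_real (ln (real (Suc n))))) =
       exp (1 / 2 * of_real (ln (real n))) / exp ((1 + w) * of_real (ln (real n))) *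
       exp (- ((w + 1 / 2) * of_real (ln (real (Suc n)) - ln (real n))))"
      by (simp only: flip: exp_diff exp_add) (simp add: algebra_simps)
    then show ?thesis
      by (simp add: gamma_quotient_def g_def mult_ac del: of_nat_Suc)
  qed
  ultimately have "(\<lambda>n. gamma_quotient w (Suc n)) \<longlonglongrightarrow> 1"
    by simp
  then show ?thesis
    by (rule LIMSEQ_imp_Suc)
qed

text \<open>
  The terms of order \<open>1 / k\<close> cancel, and those of order \<open>1 / k\<^sup>2\<close> add up to \<open>(w + 1 / 2)\<^sup>2 / (2 k\<^sup>2)\<close>. Comparison with
  \<open>1 / k - 1 / (k + 1)\<close> instead of \<open>1 / k\<^sup>2\<close> costs only another \<open>O (1 / k\<^sup>3)\<close> and makes the tails telescope.
\<close>

lemma norm_gamma_log_factor_le: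
  assumes T: "cmod w + 1 \<le> T" "T \<ge> 2" and k: "2 * T \<le> real k"
  shows "cmod (gamma_log_factor w k - (w + 1 / 2)\<^sup>2 / 2 * of_real (1 / real k - 1 / real (Suc k))) \<le> 4 * T ^ 3 / real k ^ 3"
proof -
  define E where "E = (\<lambda>u. Ln (1 + u) - u + u\<^sup>2 / 2)"
  have kr: "real k \<ge> 4" "real k > 0" using T k by auto
  have E: "cmod (E (v / of_nat k)) \<le> 2 * S ^ 3 / real k ^ 3" if "cmod v \<le> S" "S \<le> T" for v S
  proof -
    have "cmod (v / of_nat k) \<le> S / real k"
      using that kr by (simp add: norm_divide divide_right_mono)
    moreover have "S / real k \<le> 1 / 2" using k kr that by (simp add: field_simps)
    ultimately have "cmod (E (v / of_nat k)) \<le> 2 * cmod (v / of_nat k) ^ 3"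
      unfolding E_def by (intro Ln_approx_quadratic) linarith
    also have "\<dots> \<le> 2 * (S / real k) ^ 3"
      using \<open>cmod (v / of_nat k) \<le> S / real k\<close> by (intro mult_left_mono power_mono) auto
    finally show ?thesis by (simp add: power_divide)
  qed
  have ln1: "complex_of_real (ln (1 + 1 / real k)) = Ln (1 + 1 / of_nat k)"
    using kr by (subst Ln_of_real [symmetric]) (auto intro: add_pos_pos)
  have ln2: "complex_of_real (ln (1 + 1 / (2 * real k))) = Ln (1 + (1 / 2) / of_nat k)"
    using kr by (subst Ln_of_real [symmetric]) (auto intro: add_pos_pos)
  have T': "cmod (w + 1 / 2) \<le> T"
    using T norm_triangle_ineq [of w "1 / 2"] by simp
  have split: "gamma_log_factor w k - (w + 1 / 2)\<^sup>2 / 2 * of_real (1 / real k - 1 / real (Suc k)) =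
      ((w + 1 / 2) * E (1 / of_nat k) + E ((1 / 2) / of_nat k)) - E ((1 + w) / of_nat k) +
      (w + 1 / 2)\<^sup>2 / 2 * of_real (1 / real k ^ 2 - (1 / real k - 1 / real (Suc k)))"
  proof -
    define t where "t = complex_of_real (1 / real k - 1 / real (Suc k))"
    define x where "x = 1 / complex_of_nat k"
    have "(w + 1 / 2) * L1 + L2 - L3 - (w + 1 / 2)\<^sup>2 / 2 * t =
        ((w + 1 / 2) * (L1 - x + x\<^sup>2 / 2) + (L2 - x / 2 + (x / 2)\<^sup>2 / 2)) -
        (L3 - (1 + w) * x + ((1 + w) * x)\<^sup>2 / 2) + (w + 1 / 2)\<^sup>2 / 2 * (x\<^sup>2 - t)" for L1 L2 L3
      by (simp add: field_simps power2_eq_square)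
    moreover have "complex_of_real (1 / real k ^ 2 - (1 / real k - 1 / real (Suc k))) = x\<^sup>2 - t"
      by (simp add: t_def x_def power_divide)
    moreover have "(1 + w) / of_nat k = (1 + w) * x" "1 / 2 / of_nat k = x / 2" "1 / of_nat k = x"
      by (simp_all add: x_def)
    ultimately show ?thesis
      unfolding gamma_log_factor_def ln1 ln2 E_def t_def [symmetric] by (simp only:)
  qed
  have tel_eq: "1 / real k ^ 2 - (1 / real k - 1 / real (Suc k)) = 1 / (real k ^ 2 * real (Suc k))"
  proof -
    have "1 / x\<^sup>2 - (1 / x - 1 / y) = (y - x * y + x\<^sup>2) / (x\<^sup>2 * y)" if "x > 0" "y > 0" for x y :: real
      using that by (simp add: field_simps power2_eq_square)
    moreover have "real (Suc k) - real k * real (Suc k) + (real k)\<^sup>2 = 1"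
      by (simp add: algebra_simps power2_eq_square)
    ultimately show ?thesis
      using kr by (simp del: of_nat_Suc)
  qed
  then have tel0: "1 / real k ^ 2 - (1 / real k - 1 / real (Suc k)) \<ge> 0"
    by simp
  have "1 / real k ^ 2 - (1 / real k - 1 / real (Suc k)) = 1 / (real k ^ 2 * real (Suc k))"
    by (rule tel_eq)
  also have "\<dots> \<le> 1 / (real k ^ 2 * real k)"
    using kr by (intro divide_left_mono mult_left_mono mult_pos_pos) auto
  also have "\<dots> = 1 / real k ^ 3"
    by (simp add: power2_eq_square power3_eq_cube)
  finally have tel: "1 / real k ^ 2 - (1 / real k - 1 / real (Suc k)) \<le> 1 / real k ^ 3" .
  have "cmod ((w + 1 / 2)\<^sup>2 / 2 * of_real (1 / real k ^ 2 - (1 / real k - 1 / real (Suc k)))) \<le> T\<^sup>2 / 2 * (1 / real k ^ 3)"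
    unfolding norm_mult norm_of_real using tel tel0 T'
    by (intro mult_mono) (auto simp: norm_divide norm_power intro!: divide_right_mono power_mono)
  moreover have "cmod ((w + 1 / 2) * E (1 / of_nat k)) \<le> T * (2 / real k ^ 3)"
    unfolding norm_mult using E [of 1 1] T T' by (intro mult_mono) auto
  moreover have "cmod (E ((1 / 2) / of_nat k)) \<le> 2 / real k ^ 3"
  proof -
    have "cmod (E ((1 / 2) / of_nat k)) \<le> 2 * 1 ^ 3 / real k ^ 3"
      using T by (intro E) auto
    then show ?thesis by simp
  qed
  moreover have "cmod (E ((1 + w) / of_nat k)) \<le> 2 * T ^ 3 / real k ^ 3"
    using T norm_triangle_ineq [of 1 w] by (intro E) auto
  ultimately have "cmod (gamma_log_factor w k - (w + 1 / 2)\<^sup>2 / 2 * of_real (1 / real k - 1 / real (Suc k)))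
      \<le> T * (2 / real k ^ 3) + 2 / real k ^ 3 + 2 * T ^ 3 / real k ^ 3 + T\<^sup>2 / 2 * (1 / real k ^ 3)"
    unfolding split by (intro order_trans [OF norm_triangle_ineq] order_trans [OF norm_triangle_ineq4] add_mono)
  also have "\<dots> = (2 * T + 2 + 2 * T ^ 3 + T\<^sup>2 / 2) / real k ^ 3"
    by (simp add: add_divide_distrib)
  also have "\<dots> \<le> 4 * T ^ 3 / real k ^ 3"
  proof (intro divide_right_mono)
    \<comment> \<open>As \<open>T \<ge> 2\<close>, all lower powers of \<open>T\<close> are absorbed by the cube.\<close>
    have "2 * T \<le> T\<^sup>2" "2 * T\<^sup>2 \<le> T ^ 3"
      using T by (auto simp: power2_eq_square power3_eq_cube mult_right_mono)
    then show "2 * T + 2 + 2 * T ^ 3 + T\<^sup>2 / 2 \<le> 4 * T ^ 3"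
      using T by linarith
  qed auto
  finally show ?thesis .
qed

lemma summable_inverse_squares_shift: "summable (\<lambda>i. 1 / real (i + m) ^ 2)"
proof -
  have "summable (\<lambda>i. 1 / real i ^ 2)"
    using inverse_squares_sums [THEN sums_summable] summable_Suc_iff [of "\<lambda>i. 1 / real i ^ 2"] by simp
  then show ?thesis
    by (subst summable_iff_shift)
qed

text \<open>
  The main terms telescope to \<open>(w + 1 / 2)\<^sup>2 / (2 m)\<close>. In the cubic error one factor \<open>1 / k \<le> 1 / m\<close> cancels the
  factor \<open>m\<close> on the left, and the tail of a convergent series remains.
\<close>

lemma gamma_log_tail_approx:
  assumes T: "cmod w + 1 \<le> T" "T \<ge> 2" and m: "2 * T \<le> real m"
  shows "summable (\<lambda>i. gamma_log_factor w (i + m))"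
    and "cmod (of_nat m * gamma_log_tail w m - (w + 1 / 2)\<^sup>2 / 2) \<le> 4 * T ^ 3 * (\<Sum>i. 1 / real (i + m) ^ 2)"
proof -
  define c where "c = (w + 1 / 2)\<^sup>2 / 2"
  define \<tau> where "\<tau> = (\<lambda>i. c * of_real (1 / real (i + m) - 1 / real (Suc (i + m))))"
  define e where "e = (\<lambda>i. gamma_log_factor w (i + m) - \<tau> i)"
  have m0: "real m > 0" using T m by simp
  have "(\<lambda>i. 1 / real (i + m) - 1 / real (Suc i + m)) sums (1 / real (0 + m) - 0)"
    by (intro telescope_sums') real_asymp
  then have \<tau>: "\<tau> sums (c * of_real (1 / real m))"
    unfolding \<tau>_def by (intro sums_mult sums_of_real) simp
  have e_le: "cmod (e i) \<le> (4 * T ^ 3 / real m) * (1 / real (i + m) ^ 2)" for i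
  proof -
    have "cmod (e i) \<le> 4 * T ^ 3 / real (i + m) ^ 3"
      unfolding e_def \<tau>_def c_def using T m by (intro norm_gamma_log_factor_le) auto
    also have "\<dots> = 4 * T ^ 3 / (real (i + m) * real (i + m) ^ 2)"
      by (simp add: power2_eq_square power3_eq_cube mult_ac)
    also have "\<dots> \<le> 4 * T ^ 3 / (real m * real (i + m) ^ 2)"
      using T m0 by (intro divide_left_mono mult_right_mono mult_pos_pos) auto
    finally show ?thesis by simp
  qed
  have bound: "summable (\<lambda>i. (4 * T ^ 3 / real m) * (1 / real (i + m) ^ 2))"
    by (intro summable_mult summable_inverse_squares_shift)
  have e: "summable e"
    using e_le by (intro summable_comparison_test [OF _ bound]) auto
  have d: "gamma_log_factor w (i + m) = e i + \<tau> i" for i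
    by (simp add: e_def)
  show "summable (\<lambda>i. gamma_log_factor w (i + m))"
    unfolding d using e \<tau> by (intro summable_add) (auto simp: sums_iff)
  have "gamma_log_tail w m = suminf e + c * of_real (1 / real m)"
    unfolding gamma_log_tail_def d using e \<tau> by (subst suminf_add [symmetric]) (auto simp: sums_iff)
  then have "of_nat m * gamma_log_tail w m - c = of_nat m * suminf e"
    using m0 by (simp add: field_simps)
  also have "cmod \<dots> = real m * cmod (suminf e)"
    by (simp add: norm_mult)
  also have "\<dots> \<le> real m * (\<Sum>i. (4 * T ^ 3 / real m) * (1 / real (i + m) ^ 2))"
    by (intro mult_left_mono norm_suminf_le e_le bound) auto
  also have "\<dots> = 4 * T ^ 3 * (\<Sum>i. 1 / real (i + m) ^ 2)"
    using m0 by (subst suminf_mult [OF summable_inverse_squares_shift]) simp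
  finally show "cmod (of_nat m * gamma_log_tail w m - (w + 1 / 2)\<^sup>2 / 2) \<le> 4 * T ^ 3 * (\<Sum>i. 1 / real (i + m) ^ 2)"
    by (simp add: c_def)
qed

lemma gamma_log_tail_uniform:
  assumes "bounded K"
  shows "uniform_limit K (\<lambda>m w. of_nat m * gamma_log_tail w m) (\<lambda>w. (w + 1 / 2)\<^sup>2 / 2) sequentially"
proof -
  obtain R where R: "\<And>w. w \<in> K \<Longrightarrow> cmod w \<le> R"
    using assms by (auto simp: bounded_iff)
  define T where "T = max (R + 1) 2"
  have T: "cmod w + 1 \<le> T" if "w \<in> K" for w
    using R [OF that] by (simp add: T_def)
  have T2: "T \<ge> 2" by (simp add: T_def)
  show ?thesis
  proof (rule uniform_limitI)
    fix \<epsilon> :: real assume "\<epsilon> > 0"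
    then have "\<epsilon> / (4 * T ^ 3) > 0" using T2 by simp
    from suminf_exist_split [OF this, of "\<lambda>i. 1 / real (i + 0) ^ 2"] summable_inverse_squares_shift [of 0]
    obtain N where N: "\<And>n. n \<ge> N \<Longrightarrow> norm (\<Sum>i. 1 / real (i + n) ^ 2) < \<epsilon> / (4 * T ^ 3)"
      by auto
    have "\<forall>\<^sub>F m in sequentially. 2 * T \<le> real m"
      by real_asymp
    then show "\<forall>\<^sub>F m in sequentially. \<forall>w\<in>K. dist (of_nat m * gamma_log_tail w m) ((w + 1 / 2)\<^sup>2 / 2) < \<epsilon>"
      using eventually_ge_at_top [of N]
    proof eventually_elim
      case (elim m)
      have "(\<Sum>i. 1 / real (i + m) ^ 2) < \<epsilon> / (4 * T ^ 3)"
        using N [OF elim(2)] by simp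
      then have "4 * T ^ 3 * (\<Sum>i. 1 / real (i + m) ^ 2) < \<epsilon>"
        using T2 by (simp add: field_simps)
      then show ?case
        using gamma_log_tail_approx(2) [OF T T2 elim(1)] by (fastforce simp: dist_norm)
    qed
  qed
qed

text \<open>
  The product of the successive ratios from \<open>m\<close> to \<open>n + m\<close> telescopes, and the quotient tends to 1 as
  \<open>n \<rightarrow> \<infinity>\<close>.
\<close>

lemma gamma_quotient_eq_exp:
  assumes w: "Re w > - 1" and m: "m \<ge> 1"
  shows "gamma_quotient w m = exp (gamma_log_tail w m)"
proof -
  obtain N where N: "2 * max (cmod w + 1) 2 \<le> real N"
    using real_arch_simple by blast
  have "summable (\<lambda>i. gamma_log_factor w (i + N))"
    by (rule gamma_log_tail_approx(1) [OF _ _ N]) auto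
  then have summ: "summable (\<lambda>i. gamma_log_factor w (i + m))"
    by (simp only: summable_iff_shift)
  have prod: "gamma_quotient w (n + m) = gamma_quotient w m * exp (- (\<Sum>i<n. gamma_log_factor w (i + m)))" for n
  proof (induction n)
    case (Suc n)
    have "exp (- (a + b)) = exp (- a) * exp (- b)" for a b :: complex
      by (simp flip: exp_add)
    then show ?case
      using gamma_quotient_Suc [OF w, of "n + m"] m Suc by simp
  qed simp
  have "(\<lambda>n. gamma_quotient w m * exp (- (\<Sum>i<n. gamma_log_factor w (i + m)))) \<longlonglongrightarrow>
      gamma_quotient w m * exp (- gamma_log_tail w m)"
    unfolding gamma_log_tail_def by (intro tendsto_intros summable_LIMSEQ summ)
  moreover have "(\<lambda>n. gamma_quotient w (n + m)) \<longlonglongrightarrow> 1"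
    by (rule LIMSEQ_ignore_initial_segment [OF gamma_quotient_tendsto_1 [OF w]])
  ultimately have "gamma_quotient w m * exp (- gamma_log_tail w m) = 1"
    unfolding prod by (rule LIMSEQ_unique)
  then show ?thesis
    by (simp add: exp_minus field_simps)
qed

section \<open>The determinant moment as an exponential\<close>

lemma prod_Gamma_eq_power:
  fixes a :: complex
  assumes "Re a > 0"
  shows "(\<Prod>k<m. Gamma (a + of_nat k)) * (\<Prod>j<m. (a + of_nat j) ^ Suc j) = Gamma (a + of_nat m) ^ m"
proof (induction m)
  case (Suc m)
  have "(\<Prod>k<Suc m. Gamma (a + of_nat k)) * (\<Prod>j<Suc m. (a + of_nat j) ^ Suc j) =
     ((\<Prod>k<m. Gamma (a + of_nat k)) * (\<Prod>j<m. (a + of_nat j) ^ Suc j)) * (Gamma (a + of_nat m) * (a + of_nat m) ^ Suc m)"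
    by (simp add: mult_ac)
  also have "\<dots> = ((a + of_nat m) * Gamma (a + of_nat m)) ^ Suc m"
    unfolding Suc by (simp add: power_mult_distrib mult_ac)
  finally show ?case
    by (simp only: Gamma_add_of_nat_Suc [OF assms])
qed simp

text \<open>
  Division by \<open>(j + 1)\<^sup>j\<^sup>+\<^sup>1\<close> turns the left-hand side into the product of \<open>(1 + w / (j + 1))\<^sup>j\<^sup>+\<^sup>1\<close>; the
  convergence factors of the Barnes product contribute \<open>(m + 1)\<close> to the power \<open>w\<^sup>2 / 2\<close>, by telescoping, and
  \<open>exp (- m w)\<close>.
\<close>

lemma prod_shifted_powers_eq_exp:
  assumes w: "Re w > - 1"
  shows "(\<Prod>j<m. (1 + w + of_nat j) ^ Suc j) = (\<Prod>j<m. of_nat (Suc j) ^ Suc j) *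
    exp ((\<Sum>j<m. barnes_log_factor w j) - w\<^sup>2 / 2 * of_real (ln (real (Suc m))) + of_nat m * w)"
proof (induction m)
  case (Suc m)
  let ?L = "Ln (1 + w / of_nat (Suc m))"
  have nz: "1 + w / of_nat (Suc m) \<noteq> 0"
    using one_plus_divide_not_nonpos [OF w, of "Suc m"] by (auto simp del: of_nat_Suc)
  have "1 + w + of_nat m = of_nat (Suc m) * (1 + w / of_nat (Suc m))"
    by (simp add: distrib_left del: of_nat_Suc) simp
  also have "\<dots> ^ Suc m = of_nat (Suc m) ^ Suc m * exp (of_nat (Suc m) * ?L)"
    using nz by (subst exp_of_nat_mult) (simp add: power_mult_distrib del: of_nat_Suc power_Suc)
  finally have 1: "(1 + w + of_nat m) ^ Suc m = of_nat (Suc m) ^ Suc m * exp (of_nat (Suc m) * ?L)" .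
  have 2: "ln (real (Suc (Suc m))) = ln (real (Suc m)) + ln (1 + 1 / real (Suc m))"
  proof -
    have "real (Suc (Suc m)) = real (Suc m) * (1 + 1 / real (Suc m))"
      by (simp add: field_simps)
    moreover have "1 + 1 / real (Suc m) > 0"
      by (auto intro: add_pos_pos)
    ultimately show ?thesis
      by (simp only: ln_mult_pos of_nat_0_less_iff zero_less_Suc)
  qed
  have 3: "((\<Sum>j<m. barnes_log_factor w j) - w\<^sup>2 / 2 * of_real (ln (real (Suc m))) + of_nat m * w) + of_nat (Suc m) * ?L =
      (\<Sum>j<Suc m. barnes_log_factor w j) - w\<^sup>2 / 2 * of_real (ln (real (Suc (Suc m)))) + of_nat (Suc m) * w"
    unfolding sum.lessThan_Suc 2 by (simp add: barnes_log_factor_def algebra_simps)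
  show ?case
    unfolding prod.lessThan_Suc Suc 1 3 [symmetric] exp_add [of _ "of_nat (Suc m) * ?L"] by (simp only: mult_ac)
qed simp

definition gamma_ratio :: "complex \<Rightarrow> nat \<Rightarrow> complex" where
  "gamma_ratio w k = Gamma (1 + w + of_nat k) / Gamma (1 / 2 + of_nat k)"

lemma gamma_ratio_eq_exp:
  assumes "Re w > - 1" "m \<ge> 1"
  shows "gamma_ratio w m = exp ((w + 1 / 2) * of_real (ln (real m)) + gamma_log_tail w m)"
proof -
  have "gamma_ratio w m = gamma_quotient w m * exp ((w + 1 / 2) * of_real (ln (real m)))"
    by (simp add: gamma_ratio_def gamma_quotient_def exp_minus)
  then show ?thesis
    by (simp add: gamma_quotient_eq_exp [OF assms] exp_add)
qed

lemma gamma_ratio_0_nonzero: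
  assumes "Re w > - 1"
  shows "gamma_ratio w 0 \<noteq> 0"
  using right_halfplane_not_nonpos_Ints [of "1 + w"] right_halfplane_not_nonpos_Ints [of "1 / 2"] assms
  by (simp add: gamma_ratio_def Gamma_eq_zero_iff)

text \<open>
  The products of powers of natural numbers in \<open>prod_shifted_powers_eq_exp\<close> do not depend on \<open>w\<close>, so they cancel
  against those for \<open>w = - 1 / 2\<close>.
\<close>

lemma prod_gamma_ratio_eq_exp:
  assumes w: "Re w > - 1" and m: "m \<ge> 1"
  shows "(\<Prod>k<m. gamma_ratio w k) =
    exp (of_nat m * ((w + 1 / 2) * of_real (ln (real m)) + gamma_log_tail w m) +
      ((\<Sum>j<m. barnes_log_factor (- 1 / 2) j) - (\<Sum>j<m. barnes_log_factor w j)) +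
      (w\<^sup>2 / 2 - 1 / 8) * of_real (ln (real (Suc m))) - of_nat m * (w + 1 / 2))"
proof -
  define S where "S = (\<lambda>w. \<Sum>j<m. barnes_log_factor w j)"
  define P where "P = (\<lambda>w :: complex. \<Prod>j<m. (1 + w + of_nat j) ^ Suc j)"
  define l where "l = complex_of_real (ln (real (Suc m)))"
  have G: "(\<Prod>k<m. Gamma (1 + v + of_nat k)) = Gamma (1 + v + of_nat m) ^ m / P v" if "Re v > - 1" for v
  proof -
    have "P v \<noteq> 0"
      unfolding P_def prod_shifted_powers_eq_exp [OF that] by (simp del: of_nat_Suc)
    then show ?thesis
      using prod_Gamma_eq_power [of "1 + v" m] that by (simp add: P_def field_simps)
  qed
  have PP: "P (- 1 / 2) / P w = exp (S (- 1 / 2) - S w + (w\<^sup>2 / 2 - 1 / 8) * l - of_nat m * (w + 1 / 2))"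
  proof -
    have "P (- 1 / 2) / P w = exp (S (- 1 / 2) - (- 1 / 2)\<^sup>2 / 2 * l + of_nat m * (- 1 / 2)) /
        exp (S w - w\<^sup>2 / 2 * l + of_nat m * w)"
      unfolding P_def S_def l_def using w
      by (subst (1 2) prod_shifted_powers_eq_exp) (simp_all del: of_nat_Suc)
    also have "\<dots> = exp ((S (- 1 / 2) - (- 1 / 2)\<^sup>2 / 2 * l + of_nat m * (- 1 / 2)) - (S w - w\<^sup>2 / 2 * l + of_nat m * w))"
      by (simp only: exp_diff)
    also have "(S (- 1 / 2) - (- 1 / 2)\<^sup>2 / 2 * l + of_nat m * (- 1 / 2)) - (S w - w\<^sup>2 / 2 * l + of_nat m * w) =
        S (- 1 / 2) - S w + (w\<^sup>2 / 2 - 1 / 8) * l - of_nat m * (w + 1 / 2)"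
      by (simp add: algebra_simps power2_eq_square)
    finally show ?thesis .
  qed
  have "(\<Prod>k<m. gamma_ratio w k) = (\<Prod>k<m. Gamma (1 + w + of_nat k)) / (\<Prod>k<m. Gamma (1 + (- 1 / 2) + of_nat k))"
    by (simp add: gamma_ratio_def prod_dividef)
  also have "\<dots> = gamma_ratio w m ^ m * (P (- 1 / 2) / P w)"
    using w by (subst (1 2) G) (simp_all add: gamma_ratio_def power_divide)
  also have "gamma_ratio w m ^ m = exp (of_nat m * ((w + 1 / 2) * of_real (ln (real m)) + gamma_log_tail w m))"
    unfolding gamma_ratio_eq_exp [OF w m] by (rule exp_of_nat_mult [symmetric])
  finally show ?thesis
    unfolding PP S_def l_def by (simp add: algebra_simps flip: exp_add)
qed

text \<open>
  The indices \<open>\<lceil>k / 2\<rceil>\<close> run through \<open>0, 1, 1, 2, 2, \<dots>\<close>; multiplication by \<open>r 0\<close> completes the first pair.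
\<close>

lemma prod_half_indices:
  fixes r :: "nat \<Rightarrow> 'a :: comm_ring_1"
  shows "(\<Prod>k<2 * m. r (Suc k div 2)) * r 0 = (\<Prod>k<m. r k)\<^sup>2 * r m"
    and "(\<Prod>k<Suc (2 * m). r (Suc k div 2)) * r 0 = (\<Prod>k<Suc m. r k)\<^sup>2"
proof -
  have even: "(\<Prod>k<2 * m. r (Suc k div 2)) * r 0 = (\<Prod>k<m. r k)\<^sup>2 * r m" for m
  proof (induction m)
    case (Suc m)
    have "(\<Prod>k<2 * Suc m. r (Suc k div 2)) * r 0 = ((\<Prod>k<2 * m. r (Suc k div 2)) * r 0) * (r m * r (Suc m))"
      by (simp add: mult_ac)
    then show ?case
      unfolding Suc by (simp add: power2_eq_square mult_ac)
  qed simp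
  then show "(\<Prod>k<2 * m. r (Suc k div 2)) * r 0 = (\<Prod>k<m. r k)\<^sup>2 * r m" .
  have "(\<Prod>k<Suc (2 * m). r (Suc k div 2)) * r 0 = ((\<Prod>k<2 * m. r (Suc k div 2)) * r 0) * r m"
    by (simp add: mult_ac)
  then show "(\<Prod>k<Suc (2 * m). r (Suc k div 2)) * r 0 = (\<Prod>k<Suc m. r k)\<^sup>2"
    unfolding even by (simp add: power2_eq_square mult_ac)
qed

lemma hermite_norm_ratio:
  assumes z: "Re z > - 1"
  shows "hermite_norm z k / hermite_norm 0 k = exp (z / 2 * of_real (ln 2)) * gamma_ratio ((z - 1) / 2) (Suc k div 2)"
proof -
  define j where "j = Suc k div 2"
  have 1: "(z + of_nat (2 * j) + 1) / 2 = 1 + (z - 1) / 2 + of_nat j" "(0 + of_nat (2 * j) + 1) / 2 = 1 / 2 + complex_of_nat j"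
    by (simp_all add: field_simps)
  have 2: "2 powr (1 + (z - 1) / 2 + of_nat j) / 2 powr (1 / 2 + complex_of_nat j) = exp (z / 2 * of_real (ln 2))"
    by (simp add: powr_def flip: exp_diff) (simp add: field_simps Ln_of_real [of 2, simplified])
  have "hermite_norm z k / hermite_norm 0 k = gauss_moment (z + of_nat (2 * j)) / gauss_moment (0 + of_nat (2 * j))"
    by (simp add: hermite_norm_def even_falling_nonzero j_def)
  also have "\<dots> = (2 powr (1 + (z - 1) / 2 + of_nat j) / 2 powr (1 / 2 + complex_of_nat j)) * gamma_ratio ((z - 1) / 2) j"
    unfolding gauss_moment_def 1 by (simp add: gamma_ratio_def)
  finally show ?thesis
    unfolding 2 by (simp add: j_def)
qed

text \<open>
  The deterministic coefficient of \<open>z\<close> in the logarithm of the determinant moment. The term that depends on the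
  parity of \<open>n\<close> stems from the unpaired last factor for even \<open>n\<close>.
\<close>

definition GUE_log_slope :: "nat \<Rightarrow> real" where
  "GUE_log_slope n = (let m = Suc n div 2 in
     real n / 2 * ln 2 + real m * ln (real m) + (if even n then ln (real m) / 2 else 0) - ln (real (Suc m)) / 2 - real m)"

text \<open>
  Twice the exponent of \<open>prod_gamma_ratio_eq_exp\<close> contributes \<open>2 m\<close> copies of the tail. For even \<open>n\<close> the unpaired
  last factor contributes one more, so there are \<open>n + 1\<close> copies for either parity.
\<close>

lemma prod_hermite_norm_ratio_eq_exp:
  assumes z: "Re z > - 1" and n: "n \<ge> 1"
  defines "w \<equiv> (z - 1) / 2" and "m \<equiv> Suc n div 2"
  shows "(\<Prod>k<n. hermite_norm z k / hermite_norm 0 k) * gamma_ratio w 0 =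
    exp (z * of_real (GUE_log_slope n) + z\<^sup>2 / 4 * of_real (ln (real (Suc m))) + of_nat (Suc n) * gamma_log_tail w m +
      2 * ((\<Sum>j<m. barnes_log_factor (- 1 / 2) j) - (\<Sum>j<m. barnes_log_factor w j)))"
proof -
  define S where "S = (\<Sum>j<m. barnes_log_factor (- 1 / 2) j) - (\<Sum>j<m. barnes_log_factor w j)"
  define l where "l = complex_of_real (ln (real (Suc m)))"
  define r where "r = gamma_log_tail w m"
  define lm where "lm = complex_of_real (ln (real m))"
  have w: "Re w > - 1" and m: "m \<ge> 1" using z n by (auto simp: w_def m_def)
  have w': "w + 1 / 2 = z / 2" "w\<^sup>2 / 2 - 1 / 8 = z\<^sup>2 / 8 - z / 4"
    by (simp_all add: w_def field_simps power2_eq_square)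
  have square: "(\<Prod>k<m. gamma_ratio w k)\<^sup>2 = exp (z * (of_nat m * lm - l / 2 - of_nat m) + z\<^sup>2 / 4 * l + of_nat (2 * m) * r + 2 * S)"
    unfolding prod_gamma_ratio_eq_exp [OF w m] w' exp_double [symmetric] S_def [symmetric] l_def [symmetric] r_def [symmetric] lm_def [symmetric]
    by (rule arg_cong [of _ _ exp]) (simp add: algebra_simps)
  have last: "gamma_ratio w m = exp (z / 2 * lm + r)"
    unfolding gamma_ratio_eq_exp [OF w m] w' r_def lm_def ..
  have "(\<Prod>k<n. hermite_norm z k / hermite_norm 0 k) * gamma_ratio w 0 =
      exp (z / 2 * of_real (ln 2)) ^ n * ((\<Prod>k<n. gamma_ratio w (Suc k div 2)) * gamma_ratio w 0)"
    by (simp add: hermite_norm_ratio [OF z] prod.distrib w_def)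
  also have "exp (z / 2 * of_real (ln 2)) ^ n = exp (of_nat n * (z / 2 * of_real (ln 2)))"
    by (rule exp_of_nat_mult [symmetric])
  also have "(\<Prod>k<n. gamma_ratio w (Suc k div 2)) * gamma_ratio w 0 =
      exp (z * (of_nat m * lm - l / 2 - of_nat m) + z\<^sup>2 / 4 * l + of_nat (2 * m) * r + 2 * S +
        (if even n then z / 2 * lm + r else 0))"
  proof (cases "even n")
    case True
    then have "n = 2 * m" by (auto simp: m_def)
    then show ?thesis
      using True prod_half_indices(1) [of "gamma_ratio w" m] by (simp add: square last exp_add)
  next
    case False
    then obtain q where q: "n = Suc (2 * q)" "m = Suc q" by (auto simp: m_def elim!: oddE)
    have "(\<Prod>k<n. gamma_ratio w (Suc k div 2)) * gamma_ratio w 0 = (\<Prod>k<m. gamma_ratio w k)\<^sup>2"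
      using prod_half_indices(2) [of "gamma_ratio w" q] unfolding q .
    then show ?thesis
      using False by (simp only: square if_False add_0_right)
  qed
  also have "exp (of_nat n * (z / 2 * of_real (ln 2))) * \<dots> =
     exp (z * of_real (GUE_log_slope n) + z\<^sup>2 / 4 * l + of_nat (Suc n) * r + 2 * S)"
  proof -
    have *: "complex_of_real (GUE_log_slope n) =
        of_nat n / 2 * of_real (ln 2) + of_nat m * lm + (if even n then lm / 2 else 0) - l / 2 - of_nat m"
      by (simp add: GUE_log_slope_def Let_def m_def l_def lm_def)
    have "complex_of_nat (Suc n) = of_nat (2 * m) + (if even n then 1 else 0)"
      by (auto simp: m_def elim!: evenE oddE)
    then show ?thesis
      unfolding * exp_add [symmetric] by (simp only:) (simp add: algebra_simps)
  qed
  finally show ?thesis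
    unfolding l_def r_def S_def .
qed

section \<open>Locally uniform convergence\<close>

lemma filterlim_even_odd:
  assumes "filterlim (\<lambda>m. f (2 * m)) F sequentially" "filterlim (\<lambda>m. f (Suc (2 * m))) F sequentially"
  shows "filterlim f F sequentially"
  unfolding filterlim_iff
proof (intro allI impI)
  fix P assume "eventually P F"
  then obtain N1 N2 where N: "\<And>m. m \<ge> N1 \<Longrightarrow> P (f (2 * m))" "\<And>m. m \<ge> N2 \<Longrightarrow> P (f (Suc (2 * m)))"
    using assms unfolding filterlim_iff eventually_sequentially by meson
  have "P (f n)" if "n \<ge> 2 * (N1 + N2) + 1" for n
    using that N(1) [of "n div 2"] N(2) [of "n div 2"] by (cases "even n") (auto elim!: evenE oddE)
  then show "\<forall>\<^sub>F n in sequentially. P (f n)"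
    unfolding eventually_sequentially by blast
qed

lemma GUE_log_slope_limit:
  "(\<lambda>n. GUE_log_slope n - (1 / 2 * ln (2 * pi) - real n / 2 + real n / 2 * ln (real n))) \<longlonglongrightarrow> - (1 / 2 * ln (2 * pi))"
proof (rule filterlim_even_odd)
  show "(\<lambda>m. GUE_log_slope (2 * m) - (1 / 2 * ln (2 * pi) - real (2 * m) / 2 + real (2 * m) / 2 * ln (real (2 * m))))
    \<longlonglongrightarrow> - (1 / 2 * ln (2 * pi))"
    by (simp add: GUE_log_slope_def Let_def) real_asymp
  \<comment> \<open>Splitting \<open>ln (2 m + 1) = ln 2 + ln (m + 1 / 2)\<close> makes the terms with \<open>ln 2\<close> cancel identically.\<close>
  have "GUE_log_slope (Suc (2 * m)) - (1 / 2 * ln (2 * pi) - real (Suc (2 * m)) / 2 + real (Suc (2 * m)) / 2 * ln (real (Suc (2 * m)))) =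
      ((real m + 1) * ln (real m + 1) - ln (real m + 2) / 2 - 1 / 2 - (real m + 1 / 2) * ln (real m + 1 / 2)) - 1 / 2 * ln (2 * pi)" for m
  proof -
    have "real (Suc (2 * m)) = 2 * (real m + 1 / 2)" by simp
    then have "ln (real (Suc (2 * m))) = ln 2 + ln (real m + 1 / 2)"
      by (simp only:) (subst ln_mult_pos; simp)
    then show ?thesis
      by (simp add: GUE_log_slope_def Let_def field_simps)
  qed
  moreover have "(\<lambda>m. ((real m + 1) * ln (real m + 1) - ln (real m + 2) / 2 - 1 / 2 - (real m + 1 / 2) * ln (real m + 1 / 2)) - 1 / 2 * ln (2 * pi))
      \<longlonglongrightarrow> 0 - 1 / 2 * ln (2 * pi)"
    by (intro tendsto_diff tendsto_const) real_asymp
  ultimately show "(\<lambda>m. GUE_log_slope (Suc (2 * m)) - (1 / 2 * ln (2 * pi) - real (Suc (2 * m)) / 2 + real (Suc (2 * m)) / 2 * ln (real (Suc (2 * m)))))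
    \<longlonglongrightarrow> - (1 / 2 * ln (2 * pi))"
    by (simp only: diff_0)
qed

lemma half_index_limits:
  shows "(\<lambda>n. ln (real (Suc (Suc n div 2))) / 4 - ln (real n / 2) / 4) \<longlonglongrightarrow> 0"
    and "(\<lambda>n. real (Suc n) / real (Suc n div 2)) \<longlonglongrightarrow> 2"
    and "filterlim (\<lambda>n. Suc n div 2) sequentially sequentially"
proof -
  show "(\<lambda>n. ln (real (Suc (Suc n div 2))) / 4 - ln (real n / 2) / 4) \<longlonglongrightarrow> 0"
    by (rule filterlim_even_odd; simp; real_asymp)
  show "(\<lambda>n. real (Suc n) / real (Suc n div 2)) \<longlonglongrightarrow> 2"
    by (rule filterlim_even_odd; simp; real_asymp)
  show "filterlim (\<lambda>n. Suc n div 2) sequentially sequentially"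
    by (rule filterlim_even_odd; simp; real_asymp)
qed

lemma uniform_limit_scaled:
  fixes c :: "nat \<Rightarrow> real" and f :: "nat \<Rightarrow> 'a \<Rightarrow> complex"
  assumes "c \<longlonglongrightarrow> d" "uniform_limit K f g sequentially" "bounded (g ` K)"
  shows "uniform_limit K (\<lambda>n z. of_real (c n) * f n z) (\<lambda>z. of_real d * g z) sequentially"
proof (rule uniform_lim_mult [OF _ assms(2) _ assms(3)])
  show "uniform_limit K (\<lambda>n z. complex_of_real (c n)) (\<lambda>z. of_real d) sequentially"
    using assms(1) by (auto simp: uniform_limit_iff tendsto_iff dist_of_real elim: eventually_mono)
  show "bounded ((\<lambda>z. complex_of_real d) ` K)"
    by (rule bounded_subset [of "{of_real d}"]) auto
qed

lemma uniform_limit_exp: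
  fixes f :: "nat \<Rightarrow> 'a \<Rightarrow> complex"
  assumes f: "uniform_limit K f g sequentially" and g: "bounded (g ` K)"
  shows "uniform_limit K (\<lambda>n z. exp (f n z)) (\<lambda>z. exp (g z)) sequentially"
proof -
  obtain B where B: "\<And>z. z \<in> K \<Longrightarrow> cmod (g z) \<le> B"
    using g by (auto simp: bounded_iff)
  show ?thesis
  proof (rule uniform_limit_compose_uniformly_continuous_on [OF f])
    show "uniformly_continuous_on (cball 0 (B + 1)) (exp :: complex \<Rightarrow> complex)"
      by (intro compact_uniformly_continuous continuous_intros) auto
    show "\<forall>\<^sub>F n in sequentially. \<forall>z\<in>K. f n z \<in> cball 0 (B + 1)"
      using uniform_limitD [OF f, of 1, simplified]
    proof eventually_elim
      case (elim n)
      have "cmod (f n z) \<le> B + 1" if "z \<in> K" for z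
      proof -
        have "cmod (f n z - g z) < 1"
          using elim that by (auto simp: dist_norm)
        then show ?thesis
          using B [OF that] norm_triangle_sub [of "f n z" "g z"] by linarith
      qed
      then show ?case by simp
    qed
  qed auto
qed

lemma continuous_on_barnes_log_series:
  assumes K: "bounded K" "K \<subseteq> {w. Re w > - 1}"
  shows "continuous_on K (\<lambda>w. \<Sum>j. barnes_log_factor w j)"
proof -
  have "continuous_on K (\<lambda>w. barnes_log_factor w j)" for j
    unfolding barnes_log_factor_def
    by (intro continuous_intros) (use K one_plus_divide_not_nonpos [of _ "Suc j"] in \<open>auto simp del: of_nat_Suc\<close>)
  then show ?thesis
    by (intro uniform_limit_theorem [OF _ barnes_log_uniform] always_eventually allI continuous_on_sum K) auto
qed

definition GUE_limit :: "complex \<Rightarrow> complex" where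
  "GUE_limit z = Gamma (1 / 2) / Gamma ((z + 1) / 2) * ((barnes_G (1 / 2))\<^sup>2 / (barnes_G ((z + 1) / 2))\<^sup>2)"

text \<open>
  Here the elementary prefactors of the two Barnes functions combine to the linear and quadratic terms in \<open>z\<close>.
\<close>

lemma GUE_limit_eq_exp:
  assumes z: "Re z > - 1"
  defines "w \<equiv> (z - 1) / 2"
  shows "GUE_limit z = inverse (gamma_ratio w 0) *
    exp (of_real (- (1 / 2 * ln (2 * pi))) * z + z\<^sup>2 / 4 + 2 * ((\<Sum>j. barnes_log_factor (- 1 / 2) j) - (\<Sum>j. barnes_log_factor w j)))"
proof -
  define S where "S = (\<lambda>w. \<Sum>j. barnes_log_factor w j)"
  define l where "l = complex_of_real (ln (2 * pi))"
  have w: "Re w > - 1" using z by (simp add: w_def)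
  have a: "(z + 1) / 2 = 1 + w" "1 / 2 = 1 + (- 1 / 2 :: complex)" by (simp_all add: w_def field_simps)
  have sq: "(barnes_G (1 + v))\<^sup>2 = exp (2 * (v / 2 * l - (v + 1) * v / 2 + S v))" if "Re v > - 1" for v
    unfolding barnes_G_eq_exp [OF that] exp_double S_def l_def ..
  have "(barnes_G (1 / 2))\<^sup>2 / (barnes_G ((z + 1) / 2))\<^sup>2 =
      exp (2 * ((- 1 / 2) / 2 * l - ((- 1 / 2) + 1) * (- 1 / 2) / 2 + S (- 1 / 2)) - 2 * (w / 2 * l - (w + 1) * w / 2 + S w))"
    unfolding a exp_diff using w by (subst (1 2) sq) auto
  also have "2 * ((- 1 / 2) / 2 * l - ((- 1 / 2) + 1) * (- 1 / 2) / 2 + S (- 1 / 2)) - 2 * (w / 2 * l - (w + 1) * w / 2 + S w) =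
      of_real (- (1 / 2 * ln (2 * pi))) * z + z\<^sup>2 / 4 + 2 * (S (- 1 / 2) - S w)"
  proof -
    have z: "z = 2 * w + 1" by (simp add: w_def field_simps)
    have l': "complex_of_real (- (1 / 2 * ln (2 * pi))) = - l / 2" by (simp add: l_def)
    show ?thesis
      unfolding l' unfolding z by (simp add: field_simps power2_eq_square)
  qed
  finally show ?thesis
    unfolding GUE_limit_def S_def a(1) gamma_ratio_def by (simp add: field_simps)
qed

text \<open>
  The exponent splits into four parts that converge separately: the coefficients of \<open>z\<close> and \<open>z\<^sup>2\<close> after subtraction
  of the centring and the variance, the Gamma tails, and the partial Barnes sums. The quadratic term of the limit
  comes entirely from the Gamma tails.
\<close>

lemma GUE_moment_uniform_limit:
  assumes K: "compact K" "K \<subseteq> {z. Re z > - 1}"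
  shows "uniform_limit K
    (\<lambda>n z. (\<Prod>k<n. hermite_norm z k / hermite_norm 0 k) *
      exp (- (z * of_real (1 / 2 * ln (2 * pi) - real n / 2 + real n / 2 * ln (real n)))) *
      exp (- (of_real (1 / 2 * ln (real n / 2)) * z\<^sup>2 / 2)))
    GUE_limit sequentially"
proof -
  define \<mu> where "\<mu> = (\<lambda>n. 1 / 2 * ln (2 * pi) - real n / 2 + real n / 2 * ln (real n))"
  define t where "t = (\<lambda>n. 1 / 2 * ln (real n / 2))"
  define v where "v = (\<lambda>z :: complex. (z - 1) / 2)"
  define h where "h = (\<lambda>n. Suc n div 2)"
  define \<Lambda> where "\<Lambda> = (\<lambda>n z. of_real (GUE_log_slope n - \<mu> n) * z +
    of_real (ln (real (Suc (h n))) / 4 - ln (real n / 2) / 4) * z\<^sup>2 +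
    of_real (real (Suc n) / real (h n)) * (of_nat (h n) * gamma_log_tail (v z) (h n)) +
    2 * ((\<Sum>j<h n. barnes_log_factor (- 1 / 2) j) - (\<Sum>j<h n. barnes_log_factor (v z) j)))"
  define L where "L = (\<lambda>z. of_real (- (1 / 2 * ln (2 * pi))) * z + of_real 0 * z\<^sup>2 +
    of_real 2 * ((v z + 1 / 2)\<^sup>2 / 2) +
    2 * ((\<Sum>j. barnes_log_factor (- 1 / 2) j) - (\<Sum>j. barnes_log_factor (v z) j)))"
  have h: "filterlim h sequentially sequentially"
    unfolding h_def by (rule half_index_limits(3))
  have vK: "compact (v ` K)" "v ` K \<subseteq> {w. Re w > - 1}"
    using K unfolding v_def by (auto intro!: compact_continuous_image continuous_intros)
  have bdd: "bounded (f ` K)" if "continuous_on K f" for f :: "complex \<Rightarrow> complex"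
    using that K by (intro compact_imp_bounded compact_continuous_image)
  have sub: "uniform_limit K (\<lambda>n z. F (h n) (v z)) (\<lambda>z. G (v z)) sequentially"
    if "uniform_limit (v ` K) F G sequentially" for F G
    using filterlim_compose [OF uniform_limit_compose' [OF that, of v K] h] by auto
  have v_cont: "continuous_on K v"
    unfolding v_def by (intro continuous_intros) auto
  have "continuous_on K (\<lambda>z. \<Sum>j. barnes_log_factor (v z) j)"
    by (rule continuous_on_compose2 [OF continuous_on_barnes_log_series [OF compact_imp_bounded [OF vK(1)] vK(2)] v_cont]) auto
  then have L_cont: "continuous_on K L"
    unfolding L_def by (intro continuous_intros v_cont) auto
  have "uniform_limit K \<Lambda> L sequentially"
    unfolding \<Lambda>_def L_def
  proof (intro uniform_limit_add)
    show "uniform_limit K (\<lambda>n z. of_real (GUE_log_slope n - \<mu> n) * z) (\<lambda>z. of_real (- (1 / 2 * ln (2 * pi))) * z) sequentially"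
      unfolding \<mu>_def using K
      by (intro uniform_limit_scaled GUE_log_slope_limit uniform_limit_const) (auto intro: compact_imp_bounded)
    show "uniform_limit K (\<lambda>n z. of_real (ln (real (Suc (h n))) / 4 - ln (real n / 2) / 4) * z\<^sup>2) (\<lambda>z. of_real 0 * z\<^sup>2) sequentially"
      unfolding h_def by (intro uniform_limit_scaled half_index_limits uniform_limit_const bdd continuous_intros)
    show "uniform_limit K (\<lambda>n z. of_real (real (Suc n) / real (h n)) * (of_nat (h n) * gamma_log_tail (v z) (h n)))
        (\<lambda>z. of_real 2 * ((v z + 1 / 2)\<^sup>2 / 2)) sequentially"
    proof (rule uniform_limit_scaled)
      show "(\<lambda>n. real (Suc n) / real (h n)) \<longlonglongrightarrow> 2"
        unfolding h_def by (rule half_index_limits(2))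
      show "uniform_limit K (\<lambda>n z. of_nat (h n) * gamma_log_tail (v z) (h n)) (\<lambda>z. (v z + 1 / 2)\<^sup>2 / 2) sequentially"
        by (rule sub [OF gamma_log_tail_uniform]) (use vK in \<open>auto intro: compact_imp_bounded\<close>)
      show "bounded ((\<lambda>z. (v z + 1 / 2)\<^sup>2 / 2) ` K)"
        unfolding v_def by (intro bdd continuous_intros) auto
    qed
    have const: "uniform_limit K (\<lambda>n z. \<Sum>j<h n. barnes_log_factor (- 1 / 2) j) (\<lambda>z. \<Sum>j. barnes_log_factor (- 1 / 2) j) sequentially"
      using filterlim_compose [OF summable_LIMSEQ [OF summable_barnes_log_factor] h, of "- 1 / 2"]
      by (auto simp: uniform_limit_iff tendsto_iff elim: eventually_mono)
    have var: "uniform_limit K (\<lambda>n z. \<Sum>j<h n. barnes_log_factor (v z) j) (\<lambda>z. \<Sum>j. barnes_log_factor (v z) j) sequentially"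
      by (rule sub [OF barnes_log_uniform]) (use vK in \<open>auto intro: compact_imp_bounded\<close>)
    show "uniform_limit K (\<lambda>n z. 2 * ((\<Sum>j<h n. barnes_log_factor (- 1 / 2) j) - (\<Sum>j<h n. barnes_log_factor (v z) j)))
        (\<lambda>z. 2 * ((\<Sum>j. barnes_log_factor (- 1 / 2) j) - (\<Sum>j. barnes_log_factor (v z) j))) sequentially"
      by (intro bounded_linear.uniform_limit [OF bounded_linear_mult_right] uniform_limit_minus const var)
  qed
  moreover have "bounded (L ` K)"
    by (rule bdd [OF L_cont])
  ultimately have "uniform_limit K (\<lambda>n z. exp (\<Lambda> n z)) (\<lambda>z. exp (L z)) sequentially"
    by (rule uniform_limit_exp)
  moreover have "bounded ((\<lambda>z. exp (L z)) ` K)"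
    by (intro bdd continuous_on_exp L_cont)
  moreover have "bounded ((\<lambda>z. inverse (gamma_ratio (v z) 0)) ` K)"
  proof -
    have "inverse (gamma_ratio (v z) 0) = Gamma (1 / 2) * rGamma (1 + v z)" for z
      by (simp add: gamma_ratio_def rGamma_inverse_Gamma field_simps)
    moreover have "continuous_on K (\<lambda>z. Gamma (1 / 2) * rGamma (1 + v z))"
      by (intro continuous_intros continuous_on_compose2 [OF continuous_on_rGamma [of UNIV]] v_cont) auto
    ultimately show ?thesis
      by (simp add: bdd)
  qed
  ultimately have "uniform_limit K (\<lambda>n z. inverse (gamma_ratio (v z) 0) * exp (\<Lambda> n z)) (\<lambda>z. inverse (gamma_ratio (v z) 0) * exp (L z)) sequentially"
    by (intro uniform_lim_mult uniform_limit_const)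
  also have "?this \<longleftrightarrow> ?thesis"
  proof (rule uniform_limit_cong)
    show "\<forall>\<^sub>F n in sequentially. \<forall>z\<in>K. inverse (gamma_ratio (v z) 0) * exp (\<Lambda> n z) =
      (\<Prod>k<n. hermite_norm z k / hermite_norm 0 k) * exp (- (z * of_real (1 / 2 * ln (2 * pi) - real n / 2 + real n / 2 * ln (real n)))) *
      exp (- (of_real (1 / 2 * ln (real n / 2)) * z\<^sup>2 / 2))"
    proof (rule eventually_mono [OF eventually_ge_at_top [of 1]], rule ballI)
      fix n :: nat and z assume n: "1 \<le> n" and "z \<in> K"
      then have z: "Re z > - 1" using K by auto
      then have nz: "gamma_ratio (v z) 0 \<noteq> 0"
        by (intro gamma_ratio_0_nonzero) (simp add: v_def)
      have hn: "h n \<ge> 1" using n by (auto simp: h_def)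
      define M where "M = z * of_real (GUE_log_slope n) + z\<^sup>2 / 4 * of_real (ln (real (Suc (h n)))) +
        of_nat (Suc n) * gamma_log_tail (v z) (h n) +
        2 * ((\<Sum>j<h n. barnes_log_factor (- 1 / 2) j) - (\<Sum>j<h n. barnes_log_factor (v z) j))"
      have M: "(\<Prod>k<n. hermite_norm z k / hermite_norm 0 k) * gamma_ratio (v z) 0 = exp M"
        unfolding M_def v_def h_def by (rule prod_hermite_norm_ratio_eq_exp [OF z n])
      have "\<Lambda> n z = M + - (z * of_real (\<mu> n)) + - (of_real (t n) * z\<^sup>2 / 2)"
      proof -
        have "of_real (real (Suc n) / real (h n)) * (of_nat (h n) * gamma_log_tail (v z) (h n)) =
            of_nat (Suc n) * gamma_log_tail (v z) (h n)"
          using hn by (simp del: of_nat_Suc)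
        then show ?thesis
          by (simp only: \<Lambda>_def M_def t_def) (simp add: algebra_simps)
      qed
      then have "exp (\<Lambda> n z) = exp M * exp (- (z * of_real (\<mu> n))) * exp (- (of_real (t n) * z\<^sup>2 / 2))"
        by (simp only: exp_add)
      then show "inverse (gamma_ratio (v z) 0) * exp (\<Lambda> n z) =
        (\<Prod>k<n. hermite_norm z k / hermite_norm 0 k) * exp (- (z * of_real (1 / 2 * ln (2 * pi) - real n / 2 + real n / 2 * ln (real n)))) *
        exp (- (of_real (1 / 2 * ln (real n / 2)) * z\<^sup>2 / 2))"
        unfolding M [symmetric] \<mu>_def t_def using nz by (simp only:) (simp add: mult_ac)
    qed
    show "inverse (gamma_ratio (v z) 0) * exp (L z) = GUE_limit z" if "z \<in> K" for z
    proof -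
      have "L z = of_real (- (1 / 2 * ln (2 * pi))) * z + z\<^sup>2 / 4 +
          2 * ((\<Sum>j. barnes_log_factor (- 1 / 2) j) - (\<Sum>j. barnes_log_factor (v z) j))"
        by (simp add: L_def) (simp add: v_def field_simps power2_eq_square)
      then show ?thesis
        using that K GUE_limit_eq_exp [of z] by (auto simp: v_def)
    qed
  qed
  finally show ?thesis .
qed

theorem theorem4p4:
  fixes M :: "nat \<Rightarrow> 'w measure"
    and W :: "nat \<Rightarrow> 'w \<Rightarrow> complex mat"
    and \<mu> t :: "nat \<Rightarrow> real"
    and X :: "nat \<Rightarrow> 'w \<Rightarrow> real"
    and \<psi> :: "complex \<Rightarrow> complex"
  assumes GUE: "\<And>n. n \<ge> 1 \<Longrightarrow> is_normalized_GUE n (M n) (W n)"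
  defines "\<mu> \<equiv> \<lambda>n. 1 / 2 * ln (2 * pi) - real n / 2 + real n / 2 * ln (real n)"
    and "X \<equiv> \<lambda>n \<omega>. ln (cmod (Determinant.det (W n \<omega>))) - \<mu> n"
    and "t \<equiv> \<lambda>n. 1 / 2 * ln (real n / 2)"
    and "\<psi> \<equiv> \<lambda>z. Gamma (1 / 2) / Gamma ((z + 1) / 2) *
                   ((barnes_G (1 / 2))\<^sup>2 / (barnes_G ((z + 1) / 2))\<^sup>2)"
  shows "mod_gaussian_convergent M X {z. Re z > - 1} t \<psi>"
  unfolding mod_gaussian_convergent_def
proof (intro conjI allI ballI impI)
  show "\<exists>c d :: ereal. c < 0 \<and> 0 < d \<and> {z. Re z > - 1} = {z. c < ereal (Re z) \<and> ereal (Re z) < d}"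
    by (intro exI [of _ "ereal (- 1)"] exI [of _ \<infinity>]) auto
  show "filterlim t at_top sequentially"
    unfolding t_def by real_asymp
  have \<psi>: "\<psi> = GUE_limit"
    by (simp add: \<psi>_def GUE_limit_def fun_eq_iff)
  have mgf: "has_bochner_integral (M n) (\<lambda>\<omega>. exp (z * complex_of_real (X n \<omega>)))
      ((\<Prod>k<n. hermite_norm z k / hermite_norm 0 k) * exp (- (z * of_real (\<mu> n))))"
    if "n \<ge> 1" "Re z > - 1" for n z
  proof -
    have "exp (z * complex_of_real (X n \<omega>)) =
        exp (z * complex_of_real (ln (cmod (Determinant.det (W n \<omega>))))) * exp (- (z * of_real (\<mu> n)))" for \<omega>
      by (simp add: X_def algebra_simps flip: exp_add)
    then show ?thesis
      by (simp only:) (intro has_bochner_integral_mult_left GUE_det_moment GUE that)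
  qed
  show "prob_space (M n)" if "n \<ge> 1" for n
    by (rule normalized_GUE_basic(1) [OF GUE [OF that]])
  show "X n \<in> borel_measurable (M n)" if n: "n \<ge> 1" for n
  proof -
    note [measurable] = normalized_GUE_basic(3) [OF GUE [OF n]]
    show ?thesis unfolding X_def by measurable
  qed
  show "integrable (M n) (\<lambda>\<omega>. exp (z * complex_of_real (X n \<omega>)))" if "n \<ge> 1" "z \<in> {z. Re z > - 1}" for n z
    using mgf [of n z] that by (simp add: has_bochner_integral_iff)
  fix z\<^sub>0 assume "z\<^sub>0 \<in> {z. Re z > - 1}"
  moreover have "open {z. Re z > - 1}"
    by (rule open_halfspace_Re_gt)
  ultimately obtain r where r: "r > 0" "cball z\<^sub>0 r \<subseteq> {z. Re z > - 1}"
    by (meson open_contains_cball)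
  then have ball: "ball z\<^sub>0 r \<subseteq> {z. Re z > - 1}"
    using ball_subset_cball by blast
  have "uniform_limit (ball z\<^sub>0 r) (\<lambda>n z. (\<integral>\<omega>. exp (z * complex_of_real (X n \<omega>)) \<partial>M n) *
      exp (- (complex_of_real (t n) * z\<^sup>2 / 2))) \<psi> sequentially \<longleftrightarrow>
    uniform_limit (ball z\<^sub>0 r) (\<lambda>n z. (\<Prod>k<n. hermite_norm z k / hermite_norm 0 k) *
      exp (- (z * of_real (\<mu> n))) * exp (- (of_real (t n) * z\<^sup>2 / 2))) \<psi> sequentially"
  proof (rule uniform_limit_cong)
    show "\<forall>\<^sub>F n in sequentially. \<forall>z\<in>ball z\<^sub>0 r. (\<integral>\<omega>. exp (z * complex_of_real (X n \<omega>)) \<partial>M n) *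
      exp (- (complex_of_real (t n) * z\<^sup>2 / 2)) = (\<Prod>k<n. hermite_norm z k / hermite_norm 0 k) *
      exp (- (z * of_real (\<mu> n))) * exp (- (of_real (t n) * z\<^sup>2 / 2))"
    proof (rule eventually_mono [OF eventually_ge_at_top [of 1]], rule ballI)
      fix n :: nat and z assume n: "1 \<le> n" and "z \<in> ball z\<^sub>0 r"
      then have "Re z > - 1" using ball by blast
      then show "(\<integral>\<omega>. exp (z * complex_of_real (X n \<omega>)) \<partial>M n) *
      exp (- (complex_of_real (t n) * z\<^sup>2 / 2)) = (\<Prod>k<n. hermite_norm z k / hermite_norm 0 k) *
      exp (- (z * of_real (\<mu> n))) * exp (- (of_real (t n) * z\<^sup>2 / 2))"
        using has_bochner_integral_integral_eq [OF mgf [OF n]] by simp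
    qed
  qed simp
  moreover have "uniform_limit (ball z\<^sub>0 r) (\<lambda>n z. (\<Prod>k<n. hermite_norm z k / hermite_norm 0 k) *
      exp (- (z * of_real (\<mu> n))) * exp (- (of_real (t n) * z\<^sup>2 / 2))) \<psi> sequentially"
    unfolding \<psi> \<mu>_def t_def
    by (rule uniform_limit_on_subset [OF GUE_moment_uniform_limit [OF compact_cball r(2)] ball_subset_cball])
  ultimately show "\<exists>U. open U \<and> z\<^sub>0 \<in> U \<and> U \<subseteq> {z. Re z > - 1} \<and>
    uniform_limit U (\<lambda>n z. (\<integral>\<omega>. exp (z * complex_of_real (X n \<omega>)) \<partial>M n) *
      exp (- (complex_of_real (t n) * z\<^sup>2 / 2))) \<psi> sequentially"
    using r(1) ball by (intro exI [of _ "ball z\<^sub>0 r"]) simp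
qed

end
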